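(* Let $d\ge2$, $\alpha\in(0,d)$, $\delta>0$ and $m\ge\omega_d\delta^d$. For all $Q\ge0$ the problem $$\min\left\{\mathcal F_{\alpha,Q}(E):\ |E|=m,\ E\in\mathcal K_\delta^{co}\right\}$$ has a solution.
   Context: $|E|$ is Lebesgue measure in $\mathbb R^d$ and $\omega_d$ is the volume of the unit ball. $P(E)$ is the perimeter of $E$ in $\mathbb R^d$ in the sense of De Giorgi (equal to $\mathcal H^{d-1}(\partial E)$ when $E$ has smooth boundary). For $\alpha\in(0,d)$, $$\mathcal I_\alpha(E)=\inf\left\{\int_{\mathbb R^d\times\mathbb R^d}\frac{d\mu(x)\,d\mu(y)}{|x-y|^\alpha}:\ \mu \text{ non-negative Borel measure on }\mathbb R^d,\ \mu(E)=1\right\},$$ and $\mathcal F_{\alpha,Q}(E)=P(E)+Q^2\,\mathcal I_\alpha(E)$. A set $E$ satisfies the $\delta$-ball condition if for every $x\in\partial E$ there are a ball of radius $\delta$ contained in $E$ and tangent to $\partial E$ at $x$ (an open ball $B_\delta(y)\subset E$ with $|x-y|=\delta$), and a ball of radius $\delta$ contained in $E^c=\mathbb R^d\setminus E$ and tangent to $\partial E$ at $x$ (an open ball $B_\delta(z)\subset E^c$ with $|x-z|=\delta$). $\mathcal K_\delta$ is the class of all closed subsets of $\mathbb R^d$ satisfying the $\delta$-ball condition, and $\mathcal K_\delta^{co}$ is the subclass of connected sets in $\mathcal K_\delta$. *)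

theory Defs
  imports "HOL-Analysis.Analysis"
begin

definition divergence :: "('a::euclidean_space \<Rightarrow> 'a) \<Rightarrow> 'a \<Rightarrow> real" where
  "divergence T x = (\<Sum>b\<in>Basis. frechet_derivative T (at x) b \<bullet> b)"

(* C^1 is expressed by total differentiability together with continuity of all partial
   derivatives. *)
definition C1_compact_support :: "('a::euclidean_space \<Rightarrow> 'a) set" where
  "C1_compact_support =
     {T. (\<forall>x. T differentiable (at x)) \<and>
         (\<forall>b\<in>Basis. continuous_on UNIV (\<lambda>x. frechet_derivative T (at x) b)) \<and>
         compact (closure {x. T x \<noteq> 0})}"

(* De Giorgi perimeter. The coercion ennreal truncates negative values to 0; this does not
   change the supremum, because the field T = 0 is admissible and contributes 0. *)
definition perimeter :: "'a::euclidean_space set \<Rightarrow> ennreal" where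
  "perimeter E =
     (SUP T\<in>{T\<in>C1_compact_support. \<forall>x. norm (T x) \<le> 1}.
        ennreal (set_lebesgue_integral lebesgue E (divergence T)))"

(* The division takes place in ennreal, where 1 / 0 is infinite: for \<alpha> > 0 the kernel is
   infinite on the diagonal, as it should be (the real-valued 0 powr (-\<alpha>) would be 0).
   The double integral is written as an iterated one, since \<mu> ranges over all Borel measures,
   sigma-finite or not, and the library's product measure is only meaningful for sigma-finite
   factors; for those the two agree by Tonelli. *)
definition riesz_energy :: "real \<Rightarrow> 'a::euclidean_space set \<Rightarrow> ennreal" where
  "riesz_energy \<alpha> E =
     (INF \<mu>\<in>{\<mu> :: 'a measure. sets \<mu> = sets borel \<and> emeasure \<mu> E = 1}.
        \<integral>\<^sup>+x. (\<integral>\<^sup>+y. 1 / ennreal (norm (x - y) powr \<alpha>) \<partial>\<mu>) \<partial>\<mu>)"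

definition charged_energy :: "real \<Rightarrow> real \<Rightarrow> 'a::euclidean_space set \<Rightarrow> ennreal" where
  "charged_energy \<alpha> Q E = perimeter E + ennreal (Q\<^sup>2) * riesz_energy \<alpha> E"

definition ball_condition :: "real \<Rightarrow> 'a::euclidean_space set \<Rightarrow> bool" where
  "ball_condition \<delta> E \<longleftrightarrow>
     (\<forall>x\<in>frontier E.
        (\<exists>y. ball y \<delta> \<subseteq> E \<and> norm (x - y) = \<delta>) \<and>
        (\<exists>z. ball z \<delta> \<subseteq> - E \<and> norm (x - z) = \<delta>))"

definition K_class :: "real \<Rightarrow> 'a::euclidean_space set set" where
  "K_class \<delta> = {E. closed E \<and> ball_condition \<delta> E}"

definition K_class_co :: "real \<Rightarrow> 'a::euclidean_space set set" where
  "K_class_co \<delta> = {E \<in> K_class \<delta>. connected E}"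

end

theory Submission
  imports Defs "HOL-Complex_Analysis.Great_Picard"
begin

text \<open>
  The direct method. Competitors are translated to contain the origin; in a connected set of given
  volume, disjoint interior balls of radius \<open>\<delta>\<close> bound the diameter, so a minimizing sequence has a
  subsequence converging in the Hausdorff distance to a compact connected set \<open>L\<close>. Tangent balls pass
  to the limit, hence \<open>L\<close> satisfies the \<open>\<delta>\<close>-ball condition, its boundary is a null set, and the
  indicator functions converge off that boundary. This preserves the volume and makes the perimeter
  lower semicontinuous.

  For the Riesz energy no weak compactness of measures is needed. The inner unit normal of \<open>L\<close> is
  Lipschitz and extends to a Lipschitz field \<open>V\<close>; the map \<open>y \<mapsto> y + 2 \<epsilon> V(y)\<close> carries the
  \<open>\<epsilon>\<close>-neighbourhood of \<open>L\<close> into \<open>L\<close> and contracts distances at most by \<open>1 - O(\<epsilon>)\<close>. Pushing charges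
  forward along it bounds the energy of \<open>L\<close> by \<open>1 + O(\<epsilon>)\<close> times the energy of every set in that
  neighbourhood.
\<close>

subsection \<open>Tangent balls and the inner normal\<close>

lemma segment_crosses_frontier:
  fixes x y :: "'a::real_normed_vector"
  assumes "x \<in> E" "y \<notin> E"
  obtains p where "p \<in> closed_segment x y" "p \<in> frontier E"
  using connected_Int_frontier[OF connected_segment(1)[of x y], of E] assms by auto

lemma dist_ge_of_disjoint_balls:
  fixes y z :: "'a::real_normed_vector"
  assumes "ball y r \<inter> ball z r = {}"
  shows "2 * r \<le> norm (y - z)"
proof (rule ccontr)
  assume "\<not> ?thesis"
  then have "midpoint y z \<in> ball y r \<inter> ball z r"
    by (simp add: dist_midpoint) (simp add: dist_norm)
  with assms show False by blast
qed

text \<open>\<open>ball_condition\<close> supplies two unrelated centres at each boundary point.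
  Here a single unit vector determines both tangent balls, so that the normals at different points
  can be compared.\<close>

definition inner_normal :: "real \<Rightarrow> 'a::euclidean_space set \<Rightarrow> ('a \<Rightarrow> 'a) \<Rightarrow> bool" where
  "inner_normal \<delta> E n \<longleftrightarrow>
     (\<forall>x\<in>frontier E. norm (n x) = 1 \<and> ball (x + \<delta> *\<^sub>R n x) \<delta> \<subseteq> E \<and> ball (x - \<delta> *\<^sub>R n x) \<delta> \<subseteq> - E)"

text \<open>Parallelogram law. If \<open>u\<close> and \<open>w\<close> both have norm
  \<open>r\<close>, the right-hand side vanishes and \<open>w = - u\<close>; in general it converts
  a lower bound on \<open>u - w\<close> into an upper bound on \<open>u + w\<close>.\<close>

lemma norm_add_sq_le:
  fixes u w :: "'a::real_inner"
  assumes "2 * r \<le> norm (u - w)" "0 \<le> r"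
  shows "(norm (u + w))\<^sup>2 \<le> 2 * (norm u)\<^sup>2 + 2 * (norm w)\<^sup>2 - 4 * r\<^sup>2"
proof -
  have "(2 * r)\<^sup>2 \<le> (norm (u - w))\<^sup>2"
    using assms by (intro power_mono) auto
  moreover have "(norm (u + w))\<^sup>2 + (norm (u - w))\<^sup>2 = 2 * (norm u)\<^sup>2 + 2 * (norm w)\<^sup>2"
    by (simp add: power2_norm_eq_inner inner_add inner_diff algebra_simps)
  ultimately show ?thesis by (simp add: power_mult_distrib)
qed

text \<open>The two tangent balls at a boundary point are disjoint, so their centres are at least
  \<open>2 * \<delta>\<close> apart while each is \<open>\<delta>\<close> away from the point. This
  forces the point to be their midpoint.\<close>

lemma inner_normal_exists:
  fixes E :: "'a::euclidean_space set"
  assumes "ball_condition \<delta> E" "\<delta> > 0"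
  obtains n where "inner_normal \<delta> E n"
proof -
  have "\<exists>v. norm v = 1 \<and> ball (x + \<delta> *\<^sub>R v) \<delta> \<subseteq> E \<and> ball (x - \<delta> *\<^sub>R v) \<delta> \<subseteq> - E"
    if "x \<in> frontier E" for x
  proof -
    obtain y z where y: "ball y \<delta> \<subseteq> E" "norm (x - y) = \<delta>"
      and z: "ball z \<delta> \<subseteq> - E" "norm (x - z) = \<delta>"
      using assms(1) \<open>x \<in> frontier E\<close> unfolding ball_condition_def by blast
    have "2 * \<delta> \<le> norm ((y - x) - (z - x))"
      using dist_ge_of_disjoint_balls[of y \<delta> z] y z by auto
    from norm_add_sq_le[OF this] assms(2) y(2) z(2)
    have "(norm ((y - x) + (z - x)))\<^sup>2 \<le> 0"
      by (simp add: norm_minus_commute)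
    then have *: "z = x - (y - x)" by (simp add: algebra_simps)
    show ?thesis
      using assms(2) y z
      by (intro exI[of _ "(1/\<delta>) *\<^sub>R (y - x)"]) (auto simp: * norm_minus_commute)
  qed
  then obtain n where "\<forall>x\<in>frontier E. norm (n x) = 1 \<and> ball (x + \<delta> *\<^sub>R n x) \<delta> \<subseteq> E
      \<and> ball (x - \<delta> *\<^sub>R n x) \<delta> \<subseteq> - E"
    by metis
  then show ?thesis using that unfolding inner_normal_def by blast
qed

text \<open>The interior ball at \<open>x\<close> is disjoint from the exterior ball at \<open>y\<close> and vice versa; adding the
  squares of the two resulting inequalities gives the Lipschitz bound.\<close>

lemma inner_normal_lipschitz:
  fixes E :: "'a::euclidean_space set"
  assumes n: "inner_normal \<delta> E n" and \<delta>: "\<delta> > 0" and x: "x \<in> frontier E" and y: "y \<in> frontier E"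
  shows "norm (n x - n y) \<le> norm (x - y) / \<delta>"
proof -
  have nx: "norm (n x) = 1" "norm (n y) = 1"
    using n x y unfolding inner_normal_def by auto
  have "ball (x + \<delta> *\<^sub>R n x) \<delta> \<inter> ball (y - \<delta> *\<^sub>R n y) \<delta> = {}"
       "ball (y + \<delta> *\<^sub>R n y) \<delta> \<inter> ball (x - \<delta> *\<^sub>R n x) \<delta> = {}"
    using n x y unfolding inner_normal_def by blast+
  note D = this[THEN dist_ge_of_disjoint_balls]
  \<comment> \<open>The vectors from an exterior centre at one point to the interior centre at the
    other are \<open>?u + (x - y)\<close> and \<open>?u - (x - y)\<close>.\<close>
  let ?u = "\<delta> *\<^sub>R (n x + n y)"
  have "2 * \<delta> \<le> norm (?u + (x - y))" "2 * \<delta> \<le> norm (?u - (x - y))"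
    using D by (simp_all add: algebra_simps)
  then have 1: "(2 * \<delta>)\<^sup>2 \<le> (norm (?u + (x - y)))\<^sup>2"
    and 2: "2 * \<delta> \<le> norm (?u - (x - y))"
    using \<delta> by (simp_all only: power_mono)
  have "4 * \<delta>\<^sup>2 \<le> 2 * (norm ?u)\<^sup>2 + 2 * (norm (x - y))\<^sup>2 - 4 * \<delta>\<^sup>2"
    using 1 norm_add_sq_le[OF 2] \<delta> by (simp only: power_mult_distrib) simp
  \<comment> \<open>For unit vectors the squared norms of sum and difference add up to 4, so the
    lower bound on \<open>n x + n y\<close> is an upper bound on \<open>n x - n y\<close>.\<close>
  moreover have "(norm ?u)\<^sup>2 = \<delta>\<^sup>2 * (4 - (norm (n x - n y))\<^sup>2)"
  proof -
    have "n x \<bullet> n x = 1" "n y \<bullet> n y = 1"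
      using nx by (simp_all add: norm_eq_1)
    then show ?thesis
      by (simp add: power_mult_distrib power2_norm_eq_inner inner_add inner_diff inner_commute
          power2_eq_square[of \<delta>] algebra_simps)
  qed
  ultimately have "(\<delta> * norm (n x - n y))\<^sup>2 \<le> (norm (x - y))\<^sup>2"
    by (simp add: algebra_simps power_mult_distrib)
  then have "\<delta> * norm (n x - n y) \<le> norm (x - y)"
    by (rule power2_le_imp_le) simp
  then show ?thesis using \<delta> by (simp add: field_simps)
qed

section \<open>Packing bound and nullity of the boundary\<close>

lemma card_times_measure_le:
  fixes F :: "'i \<Rightarrow> 'a::euclidean_space set"
  assumes "finite I" and F: "\<And>i. i \<in> I \<Longrightarrow> F i \<in> lmeasurable"
    and "pairwise (\<lambda>i j. disjnt (F i) (F j)) I"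
    and sub: "\<And>i. i \<in> I \<Longrightarrow> F i \<subseteq> B" and "B \<in> lmeasurable"
    and c: "\<And>i. i \<in> I \<Longrightarrow> c \<le> measure lebesgue (F i)"
  shows "real (card I) * c \<le> measure lebesgue B"
proof -
  have "real (card I) * c \<le> (\<Sum>i\<in>I. measure lebesgue (F i))"
    using sum_mono[of I "\<lambda>_. c", OF c] by simp
  also have "\<dots> = measure lebesgue (\<Union>i\<in>I. F i)"
    using assms by (intro measure_UNION'[symmetric]) auto
  also have "\<dots> \<le> measure lebesgue B"
    using assms by (intro measure_mono_fmeasurable) (auto intro!: sets.finite_UN fmeasurableD)
  finally show ?thesis .
qed

text \<open>The translates of \<open>S\<close> along a segment are pairwise disjoint and stay in a fixed ball, so
  arbitrarily many copies of \<open>S\<close> fit into a set of finite measure.\<close>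

lemma negligible_disjoint_translates:
  fixes S :: "'a::euclidean_space set"
  assumes S: "S \<in> sets lebesgue" and "bounded S" and "\<delta> > 0"
    and disj: "\<And>x t. x \<in> S \<Longrightarrow> 0 < t \<Longrightarrow> t < \<delta> \<Longrightarrow> x + t *\<^sub>R v \<notin> S"
  shows "negligible S"
proof -
  have Sm: "S \<in> lmeasurable"
    using S \<open>bounded S\<close> by (rule bounded_set_imp_lmeasurable[rotated])
  obtain R where R: "S \<subseteq> cball 0 R"
    using \<open>bounded S\<close> using bounded_subset_ballD[of S 0] by (metis ball_subset_cball order_trans)
  \<comment> \<open>One ball for all translates. Its radius is independent of \<open>N\<close>, so
    letting \<open>N\<close> grow forces the measure of \<open>S\<close> to vanish.\<close>
  let ?B = "cball 0 (R + \<delta> * norm v) :: 'a set"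
  have N: "real N * measure lebesgue S \<le> measure lebesgue ?B" for N
  proof -
    \<comment> \<open>Equally spaced shifts in \<open>[0, \<delta>)\<close>: any two of them differ
      by a number in \<open>(0, \<delta>)\<close>, the range covered by \<open>disj\<close>.\<close>
    define s where "s k = \<delta> * real k / real N" for k
    have s: "0 \<le> s k" "s k < \<delta>" if "k < N" for k
      using that \<open>\<delta> > 0\<close> by (auto simp: s_def field_simps)
    have sinc: "s i < s j" if "i < j" "j < N" for i j
      using that \<open>\<delta> > 0\<close> by (auto simp: s_def field_simps)
    have dis: "disjnt ((+) (s i *\<^sub>R v) ` S) ((+) (s j *\<^sub>R v) ` S)" if "i < j" "j < N" for i j
    proof -
      have "s i *\<^sub>R v + x \<noteq> s j *\<^sub>R v + y" if "x \<in> S" "y \<in> S" for x y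
      proof
        assume "s i *\<^sub>R v + x = s j *\<^sub>R v + y"
        then have "x = y + (s j - s i) *\<^sub>R v" by (simp add: algebra_simps)
        moreover have "0 < s j - s i" "s j - s i < \<delta>"
          using sinc[OF \<open>i < j\<close> \<open>j < N\<close>] s[of j] s[of i] \<open>i < j\<close> \<open>j < N\<close> by auto
        ultimately show False using disj[OF \<open>y \<in> S\<close>] \<open>x \<in> S\<close> by blast
      qed
      then show ?thesis unfolding disjnt_def by auto
    qed
    have "real (card {..<N}) * measure lebesgue S \<le> measure lebesgue ?B"
    proof (rule card_times_measure_le[where F = "\<lambda>i. (+) (s i *\<^sub>R v) ` S"])
      show "pairwise (\<lambda>i j. disjnt ((+) (s i *\<^sub>R v) ` S) ((+) (s j *\<^sub>R v) ` S)) {..<N}"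
      proof (rule pairwiseI)
        fix i j assume "i \<in> {..<N}" "j \<in> {..<N}" "i \<noteq> j"
        then show "disjnt ((+) (s i *\<^sub>R v) ` S) ((+) (s j *\<^sub>R v) ` S)"
          using dis[of i j] dis[of j i] by (cases i j rule: linorder_cases) (auto simp: disjnt_sym)
      qed
      show "(+) (s i *\<^sub>R v) ` S \<subseteq> ?B" if i: "i \<in> {..<N}" for i
      proof safe
        fix x assume "x \<in> S"
        then have "norm (s i *\<^sub>R v + x) \<le> s i * norm v + R"
          using R s[of i] i by (intro norm_triangle_le) (auto simp: subset_eq)
        also have "\<dots> \<le> \<delta> * norm v + R"
          using s[of i] i by (intro add_mono mult_right_mono) auto
        finally show "s i *\<^sub>R v + x \<in> ?B" by (simp add: add.commute)
      qed
    qed (auto simp: Sm measurable_translation measure_translation)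
    then show ?thesis by simp
  qed
  have "measure lebesgue S = 0"
  proof (rule ccontr)
    assume "measure lebesgue S \<noteq> 0"
    then have "0 < measure lebesgue S" by (simp add: zero_less_measure_iff)
    from reals_Archimedean3[OF this, rule_format, of "measure lebesgue ?B"] N show False
      by (metis not_le)
  qed
  then show ?thesis
    using Sm by (simp add: negligible_iff_measure)
qed

text \<open>Relative to the centre of the interior tangent ball, the shifted point is
  \<open>t *\<^sub>R (v - n x) + (t - \<delta>) *\<^sub>R n x\<close>, of norm less than
  \<open>t + (\<delta> - t) = \<delta>\<close>. Directions merely close to the normal thus lead
  inward too.\<close>

lemma frontier_shift_inward:
  fixes E :: "'a::euclidean_space set"
  assumes n: "inner_normal \<delta> E n" and x: "x \<in> frontier E" and t: "0 < t" "t < \<delta>"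
    and v: "norm (v - n x) < 1"
  shows "x + t *\<^sub>R v \<in> interior E"
proof -
  have b: "ball (x + \<delta> *\<^sub>R n x) \<delta> \<subseteq> E" and n1: "norm (n x) = 1"
    using n x unfolding inner_normal_def by auto
  have "norm (t *\<^sub>R (v - n x) + (t - \<delta>) *\<^sub>R n x) \<le> t * norm (v - n x) + (\<delta> - t)"
    using t n1 by (intro norm_triangle_le) auto
  also have "\<dots> < t * 1 + (\<delta> - t)"
    using t v by (intro add_strict_right_mono mult_strict_left_mono) auto
  finally have "x + t *\<^sub>R v \<in> ball (x + \<delta> *\<^sub>R n x) \<delta>"
    by (simp add: dist_norm norm_minus_commute algebra_simps)
  with b show ?thesis
    by (meson interior_maximal open_ball subsetD)
qed

text \<open>Within distance \<open>\<delta>\<close> of a boundary point \<open>x0\<close> the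
  normals differ from \<open>n x0\<close> by less than 1. All boundary points there therefore move
  into the interior along the one direction \<open>n x0\<close>, and the local piece of the frontier
  misses its short translates.\<close>

lemma negligible_frontier_ball_condition:
  fixes E :: "'a::euclidean_space set"
  assumes "ball_condition \<delta> E" "\<delta> > 0"
  shows "negligible (frontier E)"
proof -
  obtain n where n: "inner_normal \<delta> E n"
    using inner_normal_exists[OF assms] .
  show ?thesis
  proof (rule locally_negligible_alt[THEN iffD2], rule ballI)
    fix x0 assume x0: "x0 \<in> frontier E"
    let ?U = "frontier E \<inter> ball x0 \<delta>"
    have "negligible ?U"
    proof (rule negligible_disjoint_translates)
      show "?U \<in> sets lebesgue" by simp
      show "bounded ?U" by (rule bounded_subset[OF bounded_ball]) auto
      fix x t assume xt: "x \<in> ?U" "0 < t" "t < \<delta>"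
      have "norm (n x0 - n x) \<le> norm (x0 - x) / \<delta>"
        using xt x0 inner_normal_lipschitz[OF n assms(2)] by blast
      also have "\<dots> < 1" using xt assms(2) by (auto simp: dist_norm)
      finally show "x + t *\<^sub>R n x0 \<notin> ?U"
        using frontier_shift_inward[OF n _ xt(2,3), of x "n x0"] xt(1) by (auto simp: frontier_def)
    qed (fact assms)
    then show "\<exists>U. openin (top_of_set (frontier E)) U \<and> x0 \<in> U \<and> negligible U"
      using x0 assms(2) by (intro exI[of _ ?U]) (auto intro: openin_open_Int)
  qed
qed

subsection \<open>Stability of the Riesz energy under small enlargements\<close>

text \<open>McShane's extension. An infimum of \<open>L\<close>-Lipschitz functions is
  \<open>L\<close>-Lipschitz, and at a point of \<open>S\<close> the hypothesis on \<open>f\<close>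
  makes that point itself optimal in the infimum.\<close>

lemma lipschitz_extension_real:
  fixes f :: "'a::metric_space \<Rightarrow> real"
  assumes "0 \<le> L" and f: "\<And>x y. x \<in> S \<Longrightarrow> y \<in> S \<Longrightarrow> \<bar>f x - f y\<bar> \<le> L * dist x y"
  obtains g where "\<And>x. x \<in> S \<Longrightarrow> g x = f x" "\<And>x y. \<bar>g x - g y\<bar> \<le> L * dist x y"
proof (cases "S = {}")
  case True
  then show ?thesis using that[of "\<lambda>_. 0"] \<open>0 \<le> L\<close> by simp
next
  case False
  define g where "g y = (INF x\<in>S. f x + L * dist x y)" for y
  have bdd: "bdd_below ((\<lambda>x. f x + L * dist x y) ` S)" for y
  proof -
    obtain x0 where x0: "x0 \<in> S" using False by blast
    have "f x0 - L * dist x0 y \<le> f x + L * dist x y" if "x \<in> S" for x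
    proof -
      have "L * dist x0 x \<le> L * (dist x0 y + dist x y)"
        using \<open>0 \<le> L\<close> dist_triangle2 by (intro mult_left_mono)
      then show ?thesis using f[OF x0 that] by (auto simp: algebra_simps)
    qed
    then show ?thesis by (rule bdd_belowI2)
  qed
  have le: "g y \<le> g z + L * dist y z" for y z
  proof -
    have "g y - L * dist y z \<le> f x + L * dist x z" if "x \<in> S" for x
    proof -
      have "g y \<le> f x + L * dist x y"
        unfolding g_def by (rule cINF_lower[OF bdd that])
      moreover have "L * dist x y \<le> L * (dist x z + dist y z)"
        using \<open>0 \<le> L\<close> dist_triangle2 by (intro mult_left_mono)
      ultimately show ?thesis by (simp add: algebra_simps)
    qed
    then have "g y - L * dist y z \<le> g z"
      unfolding g_def[of z] using False by (intro cINF_greatest)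
    then show ?thesis by simp
  qed
  show ?thesis
  proof (rule that[of g])
    show "\<bar>g x - g y\<bar> \<le> L * dist x y" for x y
      using le[of x y] le[of y x] by (auto simp: dist_commute)
    show "g x = f x" if "x \<in> S" for x
    proof (rule antisym)
      show "g x \<le> f x"
        unfolding g_def using cINF_lower[OF bdd that, of x] by simp
      show "f x \<le> g x"
        unfolding g_def using False f[OF that]
        by (intro cINF_greatest) (auto simp: dist_commute abs_diff_le_iff)
    qed
  qed
qed

text \<open>Extension coordinate by coordinate. The dimension enters because the norm is bounded by
  the sum of the coordinates; \<open>push_inward\<close> can use any Lipschitz constant.\<close>

lemma lipschitz_extension:
  fixes f :: "'a::metric_space \<Rightarrow> 'b::euclidean_space"
  assumes "0 \<le> L" and f: "\<And>x y. x \<in> S \<Longrightarrow> y \<in> S \<Longrightarrow> norm (f x - f y) \<le> L * dist x y"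
  obtains g where "\<And>x. x \<in> S \<Longrightarrow> g x = f x"
    "\<And>x y. norm (g x - g y) \<le> real DIM('b) * L * dist x y"
proof -
  have "\<exists>g. (\<forall>x\<in>S. g x = f x \<bullet> b) \<and> (\<forall>x y. \<bar>g x - g y\<bar> \<le> L * dist x y)" if "b \<in> Basis" for b
  proof -
    have "\<bar>f x \<bullet> b - f y \<bullet> b\<bar> \<le> L * dist x y" if "x \<in> S" "y \<in> S" for x y
      using f[OF that] Basis_le_norm[OF \<open>b \<in> Basis\<close>, of "f x - f y"] by (simp add: inner_diff_left)
    from lipschitz_extension_real[OF \<open>0 \<le> L\<close> this] show ?thesis by metis
  qed
  then obtain g where g: "\<And>b x. b \<in> Basis \<Longrightarrow> x \<in> S \<Longrightarrow> g b x = f x \<bullet> b"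
    "\<And>b x y. b \<in> Basis \<Longrightarrow> \<bar>g b x - g b y\<bar> \<le> L * dist x y"
    by metis
  define G where "G x = (\<Sum>b\<in>Basis. g b x *\<^sub>R b)" for x
  show ?thesis
  proof (rule that[of G])
    show "G x = f x" if "x \<in> S" for x
      unfolding G_def using g(1)[OF _ that] by (simp add: euclidean_representation)
    show "norm (G x - G y) \<le> real DIM('b) * L * dist x y" for x y
    proof -
      have "norm (G x - G y) \<le> (\<Sum>b\<in>Basis. \<bar>(G x - G y) \<bullet> b\<bar>)"
        by (rule norm_le_l1)
      also have "\<dots> = (\<Sum>b\<in>Basis. \<bar>g b x - g b y\<bar>)"
        by (intro sum.cong) (auto simp: G_def inner_diff_left)
      also have "\<dots> \<le> (\<Sum>b\<in>(Basis::'b set). L * dist x y)"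
        by (intro sum_mono g)
      finally show ?thesis by simp
    qed
  qed
qed

text \<open>The step \<open>2 \<epsilon>\<close> moves a point at distance \<open>\<epsilon>\<close> from \<open>E\<close> into the interior ball at a nearby
  boundary point, since \<open>V\<close> deviates from the normal there only by \<open>O(\<epsilon>)\<close>.\<close>

lemma push_inward:
  fixes E :: "'a::euclidean_space set"
  assumes "compact E" "E \<noteq> {}" "ball_condition \<delta> E" "\<delta> > 0"
  obtains V :: "'a \<Rightarrow> 'a" and L \<epsilon>0 where "L > 0" "\<And>x y. norm (V x - V y) \<le> L * norm (x - y)" "\<epsilon>0 > 0"
    "\<And>\<epsilon> y. 0 < \<epsilon> \<Longrightarrow> \<epsilon> < \<epsilon>0 \<Longrightarrow> infdist y E \<le> \<epsilon> \<Longrightarrow> y + (2 * \<epsilon>) *\<^sub>R V y \<in> E"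
proof -
  obtain n where n: "inner_normal \<delta> E n"
    using inner_normal_exists[OF assms(3,4)] .
  obtain V where V: "\<And>x. x \<in> frontier E \<Longrightarrow> V x = n x"
    "\<And>x y. norm (V x - V y) \<le> real DIM('a) * (1 / \<delta>) * dist x y"
    using lipschitz_extension[of "1 / \<delta>" "frontier E" n] inner_normal_lipschitz[OF n assms(4)] assms(4)
    by (auto simp: dist_norm)
  define L where "L = real DIM('a) * (1 / \<delta>)"
  have L: "L > 0" using assms(4) by (auto simp: L_def)
  have VL: "norm (V x - V y) \<le> L * norm (x - y)" for x y
    using V(2) by (simp add: L_def dist_norm)
  have "continuous_on E V"
    using VL L by (intro lipschitz_on_continuous_on[of L] lipschitz_onI) (auto simp: dist_norm)
  then have "bounded (V ` E)"
    using assms(1) compact_continuous_image compact_imp_bounded by blast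
  then obtain M where M: "M > 0" "\<And>y. y \<in> E \<Longrightarrow> norm (V y) \<le> M"
    unfolding bounded_pos by auto
  \<comment> \<open>For a step \<open>t = 2 * \<epsilon>\<close> the three entries give
    \<open>t < \<delta>\<close>, a variation of \<open>V\<close> below 1 along a step of length at
    most \<open>t * M\<close>, and a variation below \<open>1 / 2\<close> over the distance
    \<open>\<epsilon>\<close>.\<close>
  define \<epsilon>0 where "\<epsilon>0 = min (\<delta> / 2) (min (1 / (2 * L * M)) (1 / (2 * L)))"
  show ?thesis
  proof (rule that[OF L VL])
    show "\<epsilon>0 > 0" using L M assms(4) by (auto simp: \<epsilon>0_def)
    fix \<epsilon> y assume \<epsilon>: "0 < \<epsilon>" "\<epsilon> < \<epsilon>0" and y: "infdist y E \<le> \<epsilon>"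
    define t where "t = 2 * \<epsilon>"
    have t: "0 < t" "t < \<delta>" "L * t * M < 1" "L * \<epsilon> < 1 / 2"
      using \<epsilon> L M(1) by (auto simp: t_def \<epsilon>0_def field_simps)
    have "y + t *\<^sub>R V y \<in> E"
    proof (cases "y \<in> E")
      case True
      show ?thesis
      proof (rule ccontr)
        \<comment> \<open>If a point of \<open>E\<close> were pushed out, its path would cross the
          frontier at some \<open>p\<close>. The direction \<open>V y\<close> is within 1 of
          \<open>n p\<close>, so the rest of the path would end in the interior after all.\<close>
        assume out: "y + t *\<^sub>R V y \<notin> E"
        obtain p where p: "p \<in> closed_segment y (y + t *\<^sub>R V y)" "p \<in> frontier E"
          using segment_crosses_frontier[OF True out] .
        then obtain u where u: "0 \<le> u" "u \<le> 1" "p = y + (u * t) *\<^sub>R V y"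
          by (auto simp: in_segment algebra_simps)
        have pE: "p \<in> E" using p(2) assms(1) frontier_subset_closed compact_imp_closed by blast
        with out u have "u \<noteq> 1" by auto
        have "norm (V y - n p) \<le> L * norm (y - p)"
          using VL[of y p] V(1)[OF p(2)] by simp
        also have "\<dots> = L * (u * t * norm (V y))"
          using u t by simp
        also have "\<dots> \<le> L * (1 * t * M)"
          using u t L M(2)[OF True] by (intro mult_left_mono mult_mono) auto
        finally have "norm (V y - n p) < 1" using t by simp
        moreover have "0 < (1 - u) * t" "(1 - u) * t < \<delta>"
          using u t \<open>u \<noteq> 1\<close> by (auto intro: mult_left_le_one_le le_less_trans[of _ t])
        ultimately have "p + ((1 - u) * t) *\<^sub>R V y \<in> interior E"
          by (intro frontier_shift_inward[OF n p(2)])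
        moreover have "p + ((1 - u) * t) *\<^sub>R V y = y + t *\<^sub>R V y"
          by (simp add: u(3) algebra_simps)
        ultimately show False using out interior_subset by auto
      qed
    next
      case False
      \<comment> \<open>The segment from a nearest point of \<open>E\<close> to \<open>y\<close>
        crosses the frontier, which yields a boundary point within \<open>\<epsilon>\<close> of
        \<open>y\<close>.\<close>
      obtain x where x: "x \<in> E" "infdist y E = dist y x"
        using infdist_attains_inf[OF compact_imp_closed[OF assms(1)] assms(2)] by blast
      obtain p where p: "p \<in> closed_segment x y" "p \<in> frontier E"
        using segment_crosses_frontier[OF x(1) False] .
      have yp: "norm (y - p) \<le> \<epsilon>"
        using y x(2) segment_bound(2)[OF p(1)] by (simp add: dist_norm norm_minus_commute)
      have np: "norm (n p) = 1" "ball (p + \<delta> *\<^sub>R n p) \<delta> \<subseteq> E"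
        using n p(2) unfolding inner_normal_def by auto
      have Vy: "norm (V y - n p) < 1 / 2"
      proof -
        have "norm (V y - n p) \<le> L * norm (y - p)"
          using VL[of y p] V(1)[OF p(2)] by simp
        also have "\<dots> \<le> L * \<epsilon>" using yp L by simp
        finally show ?thesis using t by simp
      qed
      \<comment> \<open>The choice \<open>t = 2 * \<epsilon>\<close> balances the budget: the
        distance \<open>\<epsilon>\<close> and the error \<open>t / 2\<close> together equal the
        gain \<open>t\<close>. Strictness comes from \<open>Vy\<close>.\<close>
      have "norm ((y - p) + (t *\<^sub>R (V y - n p) + (t - \<delta>) *\<^sub>R n p))
          \<le> norm (y - p) + (t * norm (V y - n p) + (\<delta> - t))"
        using t np(1) by (intro norm_triangle_le add_mono order_refl) auto
      also have "\<dots> < \<epsilon> + (t * (1 / 2) + (\<delta> - t))"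
        using yp t Vy by (intro add_le_less_mono add_strict_right_mono mult_strict_left_mono) auto
      also have "\<dots> = \<delta>" by (simp add: t_def)
      finally have "y + t *\<^sub>R V y \<in> ball (p + \<delta> *\<^sub>R n p) \<delta>"
        by (simp add: dist_norm norm_minus_commute algebra_simps)
      then show ?thesis using np(2) by auto
    qed
    then show "y + (2 * \<epsilon>) *\<^sub>R V y \<in> E" by (simp add: t_def)
  qed
qed

section \<open>Riesz energy under push-forward of charges\<close>

lemma riesz_kernel_scale:
  fixes u v u' v' :: "'a::real_normed_vector"
  assumes "0 < c" "0 < \<alpha>" "c * norm (u - v) \<le> norm (u' - v')"
  shows "ennreal (c powr \<alpha>) * (1 / ennreal (norm (u' - v') powr \<alpha>)) \<le> 1 / ennreal (norm (u - v) powr \<alpha>)"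
proof (cases "u = v")
  \<comment> \<open>On the diagonal the right-hand side is \<open>1 / 0\<close>, which is infinite
    in \<open>ennreal\<close>.\<close>
  case True
  then show ?thesis by simp
next
  case False
  then have pos: "0 < norm (u - v)" by simp
  then have pos': "0 < norm (u' - v')"
    using assms by (meson less_le_trans mult_pos_pos)
  have "(c * norm (u - v)) powr \<alpha> \<le> norm (u' - v') powr \<alpha>"
    using assms pos by (intro powr_mono2) auto
  then have "c powr \<alpha> * norm (u - v) powr \<alpha> \<le> norm (u' - v') powr \<alpha>"
    using assms pos by (simp add: powr_mult)
  then have "c powr \<alpha> * (1 / norm (u' - v') powr \<alpha>) \<le> 1 / norm (u - v) powr \<alpha>"
    using pos pos' by (simp add: field_simps)
  moreover have "1 / ennreal (norm (u' - v') powr \<alpha>) = ennreal (1 / norm (u' - v') powr \<alpha>)"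
    "1 / ennreal (norm (u - v) powr \<alpha>) = ennreal (1 / norm (u - v) powr \<alpha>)"
    using pos pos' by (simp_all add: divide_ennreal flip: ennreal_1)
  ultimately show ?thesis
    by (simp add: ennreal_leI flip: ennreal_mult')
qed

text \<open>The part of a charge lying on \<open>F\<close>, pushed forward by \<Phi>, is a
  competitor for \<open>E\<close>. Distances shrink at most by the factor \<open>c\<close>, so the
  kernel grows at most by \<open>c powr (- \<alpha>)\<close>.\<close>

lemma riesz_energy_push:
  fixes E F :: "'a::euclidean_space set"
  assumes F: "F \<in> sets borel" and E: "E \<in> sets borel" and \<Phi>[measurable]: "\<Phi> \<in> borel_measurable borel"
    and sub: "\<Phi> ` F \<subseteq> E" and c: "0 < c" and \<alpha>: "0 < \<alpha>"
    and exp: "\<And>x y. x \<in> F \<Longrightarrow> y \<in> F \<Longrightarrow> c * norm (x - y) \<le> norm (\<Phi> x - \<Phi> y)"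
  shows "ennreal (c powr \<alpha>) * riesz_energy \<alpha> E \<le> riesz_energy \<alpha> F"
  unfolding riesz_energy_def[of \<alpha> F]
proof (rule INF_greatest)
  fix \<mu> :: "'a measure" assume "\<mu> \<in> {\<mu>. sets \<mu> = sets borel \<and> emeasure \<mu> F = 1}"
  then have [measurable_cong]: "sets \<mu> = sets borel" and \<mu>F: "emeasure \<mu> F = 1" by auto
  note [measurable] = F E
  let ?k = "\<lambda>x y::'a. 1 / ennreal (norm (x - y) powr \<alpha>)"
  \<comment> \<open>\<open>\<mu>\<close> need not be sigma-finite; its restriction to \<open>F\<close> is finite, which makes the inner
    integrals below measurable.\<close>
  define \<mu>' where "\<mu>' = density \<mu> (indicator F)"
  define \<nu> where "\<nu> = distr \<mu>' borel \<Phi>"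
  have [measurable_cong]: "sets \<mu>' = sets borel" by (simp add: \<mu>'_def \<open>sets \<mu> = sets borel\<close>)
  have sp: "space \<mu> = UNIV" "space \<mu>' = UNIV"
    using \<open>sets \<mu> = sets borel\<close> \<open>sets \<mu>' = sets borel\<close> by (auto dest: sets_eq_imp_space_eq)
  interpret \<mu>': finite_measure \<mu>'
    by (rule finite_measureI) (simp add: sp \<mu>'_def emeasure_density \<mu>F)
  have "emeasure \<nu> E = emeasure \<mu>' (\<Phi> -` E)"
    unfolding \<nu>_def by (subst emeasure_distr) (auto simp: sp)
  also have "\<dots> = \<integral>\<^sup>+x. indicator F x * indicator (\<Phi> -` E) x \<partial>\<mu>"
  proof -
    have "\<Phi> -` E \<in> sets \<mu>"
      using measurable_sets[OF \<Phi> E] \<open>sets \<mu> = sets borel\<close> by simp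
    then show ?thesis unfolding \<mu>'_def by (subst emeasure_density) auto
  qed
  \<comment> \<open>Since \<Phi> maps \<open>F\<close> into \<open>E\<close>, the preimage of
    \<open>E\<close> contains \<open>F\<close>.\<close>
  also have "\<dots> = \<integral>\<^sup>+x. indicator F x \<partial>\<mu>"
    using sub by (intro nn_integral_cong) (auto split: split_indicator)
  also have "\<dots> = 1" by (simp add: \<mu>F)
  finally have "emeasure \<nu> E = 1" .
  then have "riesz_energy \<alpha> E \<le> (\<integral>\<^sup>+x. (\<integral>\<^sup>+y. ?k x y \<partial>\<nu>) \<partial>\<nu>)"
    unfolding riesz_energy_def by (intro INF_lower) (auto simp: \<nu>_def)
  also have "\<dots> = (\<integral>\<^sup>+x. (\<integral>\<^sup>+y. ?k (\<Phi> x) (\<Phi> y) \<partial>\<mu>') \<partial>\<mu>')"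
    unfolding \<nu>_def by (simp add: nn_integral_distr)
  finally have "ennreal (c powr \<alpha>) * riesz_energy \<alpha> E
      \<le> ennreal (c powr \<alpha>) * (\<integral>\<^sup>+x. (\<integral>\<^sup>+y. ?k (\<Phi> x) (\<Phi> y) \<partial>\<mu>') \<partial>\<mu>')"
    by (rule mult_left_mono) simp
  also have "\<dots> = (\<integral>\<^sup>+x. (\<integral>\<^sup>+y. ennreal (c powr \<alpha>) * ?k (\<Phi> x) (\<Phi> y) \<partial>\<mu>') \<partial>\<mu>')"
    by (simp add: nn_integral_cmult)
  also have "\<dots> = (\<integral>\<^sup>+x. indicator F x * (\<integral>\<^sup>+y. indicator F y * (ennreal (c powr \<alpha>) * ?k (\<Phi> x) (\<Phi> y)) \<partial>\<mu>) \<partial>\<mu>)"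
  proof -
    have "(\<integral>\<^sup>+x. (\<integral>\<^sup>+y. ennreal (c powr \<alpha>) * ?k (\<Phi> x) (\<Phi> y) \<partial>\<mu>') \<partial>\<mu>')
      = (\<integral>\<^sup>+x. indicator F x * (\<integral>\<^sup>+y. ennreal (c powr \<alpha>) * ?k (\<Phi> x) (\<Phi> y) \<partial>\<mu>') \<partial>\<mu>)"
      by (subst (1) \<mu>'_def) (subst nn_integral_density; measurable)
    also have "\<dots> = (\<integral>\<^sup>+x. indicator F x * (\<integral>\<^sup>+y. indicator F y * (ennreal (c powr \<alpha>) * ?k (\<Phi> x) (\<Phi> y)) \<partial>\<mu>) \<partial>\<mu>)"
      unfolding \<mu>'_def by (subst nn_integral_density) auto
    finally show ?thesis .
  qed
  also have "\<dots> \<le> (\<integral>\<^sup>+x. (\<integral>\<^sup>+y. ?k x y \<partial>\<mu>) \<partial>\<mu>)"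
  proof (intro nn_integral_mono)
    fix x
    show "indicator F x * (\<integral>\<^sup>+y. indicator F y * (ennreal (c powr \<alpha>) * ?k (\<Phi> x) (\<Phi> y)) \<partial>\<mu>)
        \<le> (\<integral>\<^sup>+y. ?k x y \<partial>\<mu>)"
    proof (cases "x \<in> F")
      case True
      have "(\<integral>\<^sup>+y. indicator F y * (ennreal (c powr \<alpha>) * ?k (\<Phi> x) (\<Phi> y)) \<partial>\<mu>) \<le> (\<integral>\<^sup>+y. ?k x y \<partial>\<mu>)"
      proof (intro nn_integral_mono)
        fix y show "indicator F y * (ennreal (c powr \<alpha>) * ?k (\<Phi> x) (\<Phi> y)) \<le> ?k x y"
          using riesz_kernel_scale[OF c \<alpha> exp[OF True]] by (cases "y \<in> F") auto
      qed
      then show ?thesis using True by simp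
    qed simp
  qed
  finally show "ennreal (c powr \<alpha>) * riesz_energy \<alpha> E \<le> (\<integral>\<^sup>+x. (\<integral>\<^sup>+y. ?k x y \<partial>\<mu>) \<partial>\<mu>)" .
qed

text \<open>Lower semicontinuity in quantitative form: one \<epsilon> serves every Borel set
  \<open>F\<close> in the neighbourhood. The loss \<open>a\<close> is arbitrarily close to 1 and is
  removed at the end by letting it tend to 1.\<close>

lemma riesz_energy_neighbourhood:
  fixes E :: "'a::euclidean_space set"
  assumes "compact E" "E \<noteq> {}" "ball_condition \<delta> E" "\<delta> > 0" and \<alpha>: "0 < \<alpha>" and a: "0 < a" "a < 1"
  obtains \<epsilon> where "\<epsilon> > 0" "\<And>F. F \<in> sets borel \<Longrightarrow> (\<forall>y\<in>F. infdist y E \<le> \<epsilon>) \<Longrightarrow>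
      ennreal a * riesz_energy \<alpha> E \<le> riesz_energy \<alpha> F"
proof -
  obtain V :: "'a \<Rightarrow> 'a" and L \<epsilon>0 where V: "L > 0" "\<And>x y. norm (V x - V y) \<le> L * norm (x - y)" "\<epsilon>0 > 0"
    "\<And>\<epsilon> y. 0 < \<epsilon> \<Longrightarrow> \<epsilon> < \<epsilon>0 \<Longrightarrow> infdist y E \<le> \<epsilon> \<Longrightarrow> y + (2 * \<epsilon>) *\<^sub>R V y \<in> E"
    using push_inward[OF assms(1-4)] by metis
  define c where "c = a powr (1 / \<alpha>)"
  have c: "0 < c" "c < 1" "c powr \<alpha> = a"
    using a \<alpha> powr_less_mono2[of "1 / \<alpha>" a 1] by (auto simp: c_def powr_powr)
  \<comment> \<open>The second entry makes the Lipschitz constant \<open>2 * \<epsilon> * L\<close>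
    of the displacement at most \<open>1 - c\<close>, so \<Phi> shrinks distances by no more than
    the factor \<open>c\<close>; the first keeps \<epsilon> strictly below
    \<open>\<epsilon>0\<close>.\<close>
  define \<epsilon> where "\<epsilon> = min (\<epsilon>0 / 2) ((1 - c) / (2 * L))"
  have \<epsilon>: "0 < \<epsilon>" "\<epsilon> < \<epsilon>0" "2 * \<epsilon> * L \<le> 1 - c"
    using c V by (auto simp: \<epsilon>_def min_def field_simps)
  define \<Phi> where "\<Phi> y = y + (2 * \<epsilon>) *\<^sub>R V y" for y
  have "continuous_on UNIV V"
    using V(1,2) by (intro lipschitz_on_continuous_on[of L] lipschitz_onI) (auto simp: dist_norm)
  then have \<Phi>: "\<Phi> \<in> borel_measurable borel"
    unfolding \<Phi>_def by (intro borel_measurable_continuous_onI continuous_intros)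
  have exp: "c * norm (x - y) \<le> norm (\<Phi> x - \<Phi> y)" for x y
  proof -
    have "norm (x - y) - 2 * \<epsilon> * norm (V x - V y) \<le> norm ((x - y) + (2 * \<epsilon>) *\<^sub>R (V x - V y))"
      using norm_triangle_ineq2[of "x - y" "- ((2 * \<epsilon>) *\<^sub>R (V x - V y))"] \<epsilon>(1) by simp
    moreover have "2 * \<epsilon> * norm (V x - V y) \<le> (1 - c) * norm (x - y)"
    proof -
      have "2 * \<epsilon> * norm (V x - V y) \<le> 2 * \<epsilon> * (L * norm (x - y))"
        using V(2) \<epsilon>(1) by (intro mult_left_mono) auto
      also have "\<dots> \<le> (1 - c) * norm (x - y)"
        using mult_right_mono[OF \<epsilon>(3), of "norm (x - y)"] by (simp add: mult.assoc)
      finally show ?thesis .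
    qed
    ultimately show ?thesis by (simp add: \<Phi>_def algebra_simps)
  qed
  show ?thesis
  proof (rule that[OF \<epsilon>(1)])
    fix F :: "'a set" assume F: "F \<in> sets borel" "\<forall>y\<in>F. infdist y E \<le> \<epsilon>"
    have "\<Phi> ` F \<subseteq> E" using V(4)[OF \<epsilon>(1,2)] F(2) by (auto simp: \<Phi>_def)
    moreover have "E \<in> sets borel" using assms(1) by (simp add: borel_closed compact_imp_closed)
    ultimately show "ennreal a * riesz_energy \<alpha> E \<le> riesz_energy \<alpha> F"
      using riesz_energy_push[OF F(1) _ \<Phi> _ c(1) \<alpha> exp, of E] by (simp add: c(3))
  qed
qed

subsection \<open>Perimeter and translations\<close>

text \<open>The divergence is continuous and vanishes off the compact closure of the support, near
  whose complement points \<open>T\<close> is constantly 0. Integrability makes it a majorant for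
  dominated convergence.\<close>

lemma C1_compact_support_divergence:
  fixes T :: "'a::euclidean_space \<Rightarrow> 'a"
  assumes "T \<in> C1_compact_support"
  shows "divergence T \<in> borel_measurable borel" "integrable lebesgue (divergence T)"
proof -
  have cont: "\<And>b. b \<in> Basis \<Longrightarrow> continuous_on UNIV (\<lambda>x. frechet_derivative T (at x) b)"
    and K: "compact (closure {x. T x \<noteq> 0})"
    using assms unfolding C1_compact_support_def by auto
  have c: "continuous_on UNIV (divergence T)"
    unfolding divergence_def using cont by (intro continuous_intros) auto
  then show m: "divergence T \<in> borel_measurable borel"
    by (rule borel_measurable_continuous_onI)
  have "divergence T x = 0" if "x \<notin> closure {x. T x \<noteq> 0}" for x
  proof -
    have "((\<lambda>_. 0::'a) has_derivative (\<lambda>_. 0)) (at x)" by simp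
    then have "(T has_derivative (\<lambda>_. 0)) (at x)"
    proof (rule has_derivative_transform_within_open)
      show "open (- closure {x. T x \<noteq> 0})" "x \<in> - closure {x. T x \<noteq> 0}" using that by auto
      show "0 = T y" if "y \<in> - closure {x. T x \<noteq> 0}" for y
        using that closure_subset[of "{x. T x \<noteq> 0}"] by fastforce
    qed
    from frechet_derivative_at[OF this, symmetric] show ?thesis
      by (simp add: divergence_def)
  qed
  then have "divergence T = (\<lambda>x. indicator (closure {x. T x \<noteq> 0}) x *\<^sub>R divergence T x)"
    by (auto simp: indicator_def fun_eq_iff)
  moreover have "integrable lborel (\<lambda>x. indicator (closure {x. T x \<noteq> 0}) x *\<^sub>R divergence T x)"
    using K c by (intro borel_integrable_compact) (auto intro: continuous_on_subset)
  ultimately have "integrable lborel (divergence T)" by (simp only:)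
  then show "integrable lebesgue (divergence T)"
    using m by (simp add: integrable_completion)
qed

text \<open>Dominated convergence with majorant \<open>norm (f x)\<close>. It is used with a
  divergence for the perimeter and with the indicator of a large ball for the volume.\<close>

lemma set_lebesgue_integral_tendsto:
  fixes f :: "'a::euclidean_space \<Rightarrow> real"
  assumes f: "integrable lebesgue f" and E: "\<And>n. E n \<in> sets lebesgue" "L \<in> sets lebesgue"
    and lim: "AE x in lebesgue. \<forall>\<^sub>F n in sequentially. x \<in> E n \<longleftrightarrow> x \<in> L"
  shows "(\<lambda>n. set_lebesgue_integral lebesgue (E n) f) \<longlonglongrightarrow> set_lebesgue_integral lebesgue L f"
  unfolding set_lebesgue_integral_def
proof (rule integral_dominated_convergence[where w = "\<lambda>x. norm (f x)"])
  have [measurable]: "f \<in> borel_measurable lebesgue" using f by auto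
  note [measurable] = E
  show "(\<lambda>x. indicat_real L x *\<^sub>R f x) \<in> borel_measurable lebesgue" by measurable
  show "(\<lambda>x. indicat_real (E i) x *\<^sub>R f x) \<in> borel_measurable lebesgue" for i by measurable
  show "AE x in lebesgue. (\<lambda>i. indicat_real (E i) x *\<^sub>R f x) \<longlonglongrightarrow> indicat_real L x *\<^sub>R f x"
    using lim
  proof eventually_elim
    case (elim x)
    then have "\<forall>\<^sub>F i in sequentially. indicat_real (E i) x *\<^sub>R f x = indicat_real L x *\<^sub>R f x"
      by eventually_elim (simp add: indicator_def)
    then show ?case by (rule tendsto_eventually)
  qed
qed (use f in \<open>auto simp: indicator_def\<close>)

lemma C1_compact_support_translate:
  fixes T :: "'a::euclidean_space \<Rightarrow> 'a"
  assumes "T \<in> C1_compact_support"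
  shows "(\<lambda>x. T (a + x)) \<in> C1_compact_support"
    and "divergence (\<lambda>x. T (a + x)) x = divergence T (a + x)"
proof -
  have diff: "\<And>x. T differentiable (at x)"
    and cont: "\<And>b. b \<in> Basis \<Longrightarrow> continuous_on UNIV (\<lambda>x. frechet_derivative T (at x) b)"
    and K: "compact (closure {x. T x \<noteq> 0})"
    using assms unfolding C1_compact_support_def by auto
  have D: "((\<lambda>x. T (a + x)) has_derivative frechet_derivative T (at (a + x))) (at x)" for x
  proof -
    have "((\<lambda>x. a + x) has_derivative (\<lambda>h. h)) (at x)"
      by (auto intro!: derivative_eq_intros)
    from has_derivative_compose[OF this] diff[of "a + x"] show ?thesis
      by (auto simp: frechet_derivative_works)
  qed
  then have F: "frechet_derivative (\<lambda>x. T (a + x)) (at x) = frechet_derivative T (at (a + x))" for x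
    using frechet_derivative_at[OF D] by metis
  show "divergence (\<lambda>x. T (a + x)) x = divergence T (a + x)" for x
    unfolding divergence_def F ..
  have "{x. T (a + x) \<noteq> 0} = (+) (- a) ` {x. T x \<noteq> 0}"
    by (auto intro!: image_eqI[where x = "a + x" for x])
  then have "compact (closure {x. T (a + x) \<noteq> 0})"
    by (simp only: closure_translation compact_translation[OF K])
  moreover have "continuous_on UNIV (\<lambda>x. frechet_derivative T (at (a + x)) b)" if "b \<in> Basis" for b
    by (rule continuous_on_compose2[OF cont[OF that]]) (auto intro: continuous_intros)
  ultimately show "(\<lambda>x. T (a + x)) \<in> C1_compact_support"
    using D by (auto simp: C1_compact_support_def F intro: differentiableI)
qed

lemma set_lebesgue_integral_translate:
  fixes f :: "'a::euclidean_space \<Rightarrow> real"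
  assumes [measurable]: "E \<in> sets borel" "f \<in> borel_measurable borel"
  shows "set_lebesgue_integral lebesgue ((+) a ` E) f = set_lebesgue_integral lebesgue E (\<lambda>x. f (a + x))"
proof -
  have im: "(+) a ` E = (\<lambda>x. - a + x) -` E \<inter> space borel"
    by (auto intro!: image_eqI[where x = "- a + x" for x])
  have [measurable]: "(+) a ` E \<in> sets borel"
    unfolding im by measurable
  have "set_lebesgue_integral lebesgue ((+) a ` E) f = (\<integral>x. indicat_real ((+) a ` E) x *\<^sub>R f x \<partial>lborel)"
    unfolding set_lebesgue_integral_def by (rule integral_completion) measurable
  also have "\<dots> = (\<integral>x. indicat_real ((+) a ` E) x *\<^sub>R f x \<partial>distr lborel borel ((+) a))"
    by (simp add: lborel_distr_plus)
  also have "\<dots> = (\<integral>x. indicat_real ((+) a ` E) (a + x) *\<^sub>R f (a + x) \<partial>lborel)"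
    by (rule integral_distr) measurable
  also have "\<dots> = (\<integral>x. indicat_real E x *\<^sub>R f (a + x) \<partial>lborel)"
    by (intro Bochner_Integration.integral_cong) (auto simp: indicator_def)
  also have "\<dots> = set_lebesgue_integral lebesgue E (\<lambda>x. f (a + x))"
    unfolding set_lebesgue_integral_def by (rule integral_completion[symmetric]) measurable
  finally show ?thesis .
qed

text \<open>Translating a test field for the moved set gives an admissible field for
  \<open>E\<close> with the same integral.\<close>

lemma perimeter_translate_le:
  fixes E :: "'a::euclidean_space set"
  assumes E: "E \<in> sets borel"
  shows "perimeter ((+) a ` E) \<le> perimeter E"
  unfolding perimeter_def[of "(+) a ` E"]
proof (rule SUP_least)
  fix T assume T: "T \<in> {T \<in> C1_compact_support. \<forall>x. norm (T x :: 'a) \<le> 1}"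
  then have T1: "T \<in> C1_compact_support" by simp
  have "divergence (\<lambda>x. T (a + x)) = (\<lambda>x. divergence T (a + x))"
    by (rule ext) (rule C1_compact_support_translate(2)[OF T1])
  then have "set_lebesgue_integral lebesgue ((+) a ` E) (divergence T)
      = set_lebesgue_integral lebesgue E (divergence (\<lambda>x. T (a + x)))"
    using set_lebesgue_integral_translate[OF E C1_compact_support_divergence(1)[OF T1]] by simp
  also have "ennreal \<dots> \<le> perimeter E"
    unfolding perimeter_def using T by (intro SUP_upper) (auto intro: C1_compact_support_translate)
  finally show "ennreal (set_lebesgue_integral lebesgue ((+) a ` E) (divergence T)) \<le> perimeter E" .
qed

text \<open>A translation is an isometry, so \<open>riesz_energy_push\<close> applies with
  \<open>c = 1\<close>. The inequality lets a translated minimizing sequence be squeezed between the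
  infimum and the original energies.\<close>

lemma charged_energy_translate_le:
  fixes E :: "'a::euclidean_space set"
  assumes E: "closed E" and "0 < \<alpha>"
  shows "charged_energy \<alpha> Q ((+) a ` E) \<le> charged_energy \<alpha> Q E"
proof -
  have b: "E \<in> sets borel" "(+) a ` E \<in> sets borel"
    using E by (auto intro: borel_closed closed_translation)
  have "ennreal (1 powr \<alpha>) * riesz_energy \<alpha> ((+) a ` E) \<le> riesz_energy \<alpha> E"
    using b assms(2) by (intro riesz_energy_push[where \<Phi> = "(+) a"]) auto
  then show ?thesis
    unfolding charged_energy_def using perimeter_translate_le[OF b(1), of a]
    by (intro add_mono mult_left_mono) auto
qed

lemma K_class_co_translate:
  fixes E :: "'a::euclidean_space set"
  assumes "E \<in> K_class_co \<delta>"
  shows "(+) a ` E \<in> K_class_co \<delta>"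
proof -
  have E: "closed E" "ball_condition \<delta> E" "connected E"
    using assms by (auto simp: K_class_co_def K_class_def)
  have C: "- ((+) a ` E) = (+) a ` (- E)"
    by (simp add: translation_Compl)
  have "ball_condition \<delta> ((+) a ` E)"
    unfolding ball_condition_def frontier_translation
  proof safe
    fix x assume "x \<in> frontier E"
    then obtain y z where y: "ball y \<delta> \<subseteq> E" "norm (x - y) = \<delta>" and z: "ball z \<delta> \<subseteq> - E" "norm (x - z) = \<delta>"
      using E(2) unfolding ball_condition_def by blast
    have "ball (a + y) \<delta> \<subseteq> (+) a ` E" "ball (a + z) \<delta> \<subseteq> - ((+) a ` E)"
      unfolding C ball_translation by (rule image_mono[OF y(1)], rule image_mono[OF z(1)])
    moreover have "norm (a + x - (a + y)) = \<delta>" "norm (a + x - (a + z)) = \<delta>"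
      using y(2) z(2) by simp_all
    ultimately show "\<exists>y. ball y \<delta> \<subseteq> (+) a ` E \<and> norm (a + x - y) = \<delta>"
      "\<exists>z. ball z \<delta> \<subseteq> - (+) a ` E \<and> norm (a + x - z) = \<delta>"
      by blast+
  qed
  moreover have "connected ((+) a ` E)"
    by (rule connected_continuous_image[OF _ E(3)]) (intro continuous_intros)
  ultimately show ?thesis
    using closed_translation[OF E(1)] unfolding K_class_co_def K_class_def by blast
qed

subsection \<open>Hausdorff limits\<close>

lemma infdist_less_imp_ex:
  assumes "infdist x S < r" "S \<noteq> {}"
  shows "\<exists>l\<in>S. dist x l < r"
proof (rule ccontr)
  assume "\<not> ?thesis"
  then have "r \<le> (INF l\<in>S. dist x l)"
    using assms(2) by (intro cINF_greatest) auto
  with assms show False by (simp add: infdist_def)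
qed

text \<open>For nonempty sets only: \<open>infdist x {} = 0\<close>.\<close>

definition hausdorff_converges :: "(nat \<Rightarrow> 'a::metric_space set) \<Rightarrow> 'a set \<Rightarrow> bool" where
  "hausdorff_converges E L \<longleftrightarrow>
     (\<forall>\<epsilon>>0. \<forall>\<^sub>F n in sequentially. (\<forall>x\<in>E n. infdist x L \<le> \<epsilon>) \<and> (\<forall>x\<in>L. infdist x (E n) \<le> \<epsilon>))"

text \<open>The distance functions of the sets are 1-Lipschitz and uniformly bounded on the ball.
  Arzela-Ascoli gives a uniformly convergent subsequence; the limit set is the zero set of the limit
  function \<open>g\<close>.\<close>

lemma blaschke_selection:
  fixes E :: "nat \<Rightarrow> 'a::euclidean_space set"
  assumes E: "\<And>n. closed (E n)" "\<And>n. E n \<noteq> {}" "\<And>n. E n \<subseteq> cball 0 R"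
  obtains k L where "strict_mono (k :: nat \<Rightarrow> nat)" "compact L" "L \<noteq> {}" "L \<subseteq> cball 0 R"
    "hausdorff_converges (E \<circ> k) L"
proof -
  let ?K = "cball 0 R :: 'a set"
  obtain g k where g: "continuous_on ?K g" "strict_mono (k :: nat \<Rightarrow> nat)"
    and lim: "\<And>e. 0 < e \<Longrightarrow> \<exists>N. \<forall>n x. n \<ge> N \<and> x \<in> ?K \<longrightarrow> norm (infdist x (E (k n)) - g x) < e"
  proof (rule Arzela_Ascoli[of ?K "\<lambda>n x. infdist x (E n)" "2 * R"])
    show "norm (infdist x (E n)) \<le> 2 * R" if "x \<in> ?K" for n x
    proof -
      obtain e where e: "e \<in> E n" using E(2) by blast
      have "infdist x (E n) \<le> dist x e" using e by (rule infdist_le)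
      also have "\<dots> \<le> R + R"
        using that e E(3) dist_triangle[of x e 0] by (fastforce simp: subset_eq dist_commute)
      finally show ?thesis by (simp add: infdist_nonneg)
    qed
    show "\<exists>d>0. \<forall>n y. y \<in> ?K \<and> norm (x - y) < d \<longrightarrow> norm (infdist x (E n) - infdist y (E n)) < e"
      if "0 < e" for x e
      using that infdist_triangle_abs[of x _ ] by (intro exI[of _ e]) (auto simp: dist_norm intro: le_less_trans)
  qed auto
  have glim: "(\<lambda>n. infdist x (E (k n))) \<longlonglongrightarrow> g x" if "x \<in> ?K" for x
    using lim that by (intro LIMSEQ_I) blast
  have g0: "0 \<le> g x" if "x \<in> ?K" for x
    using LIMSEQ_le_const[OF glim[OF that]] infdist_nonneg by blast
  define L where "L = {x \<in> ?K. g x = 0}"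
  \<comment> \<open>Nearest points to \<open>x\<close> in the sets subconverge to a zero of
    \<open>g\<close> at distance \<open>g x\<close>. Hence \<open>infdist x L \<le> g x\<close>, and
    \<open>L\<close> is nonempty.\<close>
  have key: "\<exists>l\<in>L. dist x l = g x" if x: "x \<in> ?K" for x
  proof -
    have "\<exists>e\<in>E n. infdist x (E n) = dist x e" for n
      using infdist_attains_inf[OF E(1,2)] by blast
    then obtain e where e: "\<And>n. e n \<in> E n" "\<And>n. infdist x (E n) = dist x (e n)" by metis
    have "\<forall>n. e (k n) \<in> ?K" using e(1) E(3) by blast
    then obtain l r where l: "l \<in> ?K" "strict_mono (r :: nat \<Rightarrow> nat)" "((\<lambda>n. e (k n)) \<circ> r) \<longlonglongrightarrow> l"
      by (rule seq_compactE[OF compact_imp_seq_compact[OF compact_cball]])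
    then have lim_e: "(\<lambda>n. e (k (r n))) \<longlonglongrightarrow> l" by (simp add: o_def)
    have "(\<lambda>n. dist x (e (k (r n)))) \<longlonglongrightarrow> dist x l"
      by (intro tendsto_intros lim_e)
    moreover have "(\<lambda>n. dist x (e (k (r n)))) \<longlonglongrightarrow> g x"
      using LIMSEQ_subseq_LIMSEQ[OF glim[OF x] l(2)] by (simp add: o_def e(2))
    ultimately have "dist x l = g x" by (rule LIMSEQ_unique)
    moreover have "g l \<le> 0"
    proof (rule LIMSEQ_le)
      show "(\<lambda>n. infdist l (E (k (r n)))) \<longlonglongrightarrow> g l"
        using LIMSEQ_subseq_LIMSEQ[OF glim[OF l(1)] l(2)] by (simp add: o_def)
      have "(\<lambda>n. dist l (e (k (r n)))) \<longlonglongrightarrow> dist l l" by (intro tendsto_intros lim_e)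
      then show "(\<lambda>n. dist l (e (k (r n)))) \<longlonglongrightarrow> 0" by simp
      show "\<exists>N. \<forall>n\<ge>N. infdist l (E (k (r n))) \<le> dist l (e (k (r n)))"
        using e(1) by (auto intro: infdist_le)
    qed
    then have "l \<in> L" using g0[OF l(1)] l(1) by (auto simp: L_def)
    ultimately show ?thesis by blast
  qed
  show ?thesis
  proof (rule that[OF g(2)])
    have "closed L"
      unfolding L_def using g(1) by (intro continuous_closed_preimage_constant) auto
    then show "compact L"
      unfolding compact_eq_bounded_closed
      using bounded_subset[OF bounded_cball, of L 0 R] by (auto simp only: L_def)
    show "L \<subseteq> ?K" by (auto simp: L_def)
    obtain e where "e \<in> E 0" using E(2) by blast
    then show "L \<noteq> {}" using key[of e] E(3)[of 0] by blast
    show "hausdorff_converges (E \<circ> k) L"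
      unfolding hausdorff_converges_def
    proof (intro allI impI)
      fix \<epsilon> :: real assume "\<epsilon> > 0"
      then obtain N where N: "\<And>n x. n \<ge> N \<Longrightarrow> x \<in> ?K \<Longrightarrow> norm (infdist x (E (k n)) - g x) < \<epsilon>"
        using lim by blast
      \<comment> \<open>On \<open>E (k n)\<close> the distance to that set is 0, so \<open>g\<close>
        is small there by uniform convergence; the other half uses \<open>g = 0\<close> on
        \<open>L\<close>.\<close>
      have "infdist x L \<le> \<epsilon>" if "n \<ge> N" "x \<in> E (k n)" for n x
      proof -
        have x: "x \<in> ?K" using that E(3) by blast
        obtain l where "l \<in> L" "dist x l = g x" using key[OF x] by blast
        then have "infdist x L \<le> g x" using infdist_le by metis
        then show ?thesis using N[OF that(1) x] that(2) by simp
      qed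
      moreover have "infdist x (E (k n)) \<le> \<epsilon>" if "n \<ge> N" "x \<in> L" for n x
        using N[OF that(1), of x] that(2) by (simp add: L_def)
      ultimately show "\<forall>\<^sub>F n in sequentially. (\<forall>x\<in>(E \<circ> k) n. infdist x L \<le> \<epsilon>) \<and> (\<forall>x\<in>L. infdist x ((E \<circ> k) n) \<le> \<epsilon>)"
        unfolding eventually_sequentially by (auto intro!: exI[of _ N])
    qed
  qed
qed

text \<open>A point of the limit is either approached by boundary points of infinitely many \<open>E n\<close>, and then the
  tangent balls there subconverge to tangent balls of the limit, or a fixed ball around it eventually
  lies in \<open>E n\<close>.\<close>

context
  fixes E :: "nat \<Rightarrow> 'a::euclidean_space set" and L :: "'a set"
  assumes H: "hausdorff_converges E L" and L: "closed L" "L \<noteq> {}" and E: "\<And>n. E n \<noteq> {}"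
begin

lemma hausdorff_converges_eventually:
  assumes "\<epsilon> > 0"
  shows "\<forall>\<^sub>F n in sequentially. \<forall>x\<in>E n. infdist x L \<le> \<epsilon>"
    "\<forall>\<^sub>F n in sequentially. \<forall>x\<in>L. infdist x (E n) \<le> \<epsilon>"
proof -
  have "\<forall>\<^sub>F n in sequentially. (\<forall>x\<in>E n. infdist x L \<le> \<epsilon>) \<and> (\<forall>x\<in>L. infdist x (E n) \<le> \<epsilon>)"
    using H assms unfolding hausdorff_converges_def by blast
  then show "\<forall>\<^sub>F n in sequentially. \<forall>x\<in>E n. infdist x L \<le> \<epsilon>"
    "\<forall>\<^sub>F n in sequentially. \<forall>x\<in>L. infdist x (E n) \<le> \<epsilon>"
    by (simp_all add: eventually_conj_iff)
qed

text \<open>The hypothesis with infinitely many \<open>n\<close>, here and in the next lemma, allows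
  an application along subsequences.\<close>

lemma hausdorff_limit_memI:
  assumes "\<exists>\<^sub>F n in sequentially. w \<in> E n"
  shows "w \<in> L"
proof -
  have "infdist w L \<le> \<epsilon>" if "\<epsilon> > 0" for \<epsilon>
  proof -
    show ?thesis
      using frequently_ex[OF frequently_eventually_conj[OF assms hausdorff_converges_eventually(1)[OF that]]]
      by auto
  qed
  then have "infdist w L = 0"
    using infdist_nonneg by (metis dual_order.antisym field_le_epsilon add_0)
  then show ?thesis using L by (simp add: in_closed_iff_infdist_zero)
qed

text \<open>A point outside every \<open>E n\<close> may still lie in the limit. Missing a whole
  ball of fixed radius keeps its distance to \<open>E n\<close> bounded below.\<close>

lemma hausdorff_limit_notmemI:
  assumes "\<exists>\<^sub>F n in sequentially. ball w r \<subseteq> - E n" "r > 0"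
  shows "w \<notin> L"
proof
  assume "w \<in> L"
  have "\<forall>\<^sub>F n in sequentially. \<forall>x\<in>L. infdist x (E n) \<le> r / 2"
    using \<open>r > 0\<close> by (intro hausdorff_converges_eventually) simp
  from frequently_ex[OF frequently_eventually_conj[OF assms(1) this]]
  obtain n where n: "ball w r \<subseteq> - E n" "infdist w (E n) \<le> r / 2"
    using \<open>w \<in> L\<close> by auto
  then have "infdist w (E n) < r" using \<open>r > 0\<close> by simp
  from infdist_less_imp_ex[OF this E] n(1) show False by (auto simp: subset_eq)
qed

lemma hausdorff_limit_balls:
  assumes bc: "\<And>n. ball_condition \<delta> (E n)" and "\<delta> > 0"
    and fr: "\<And>r. r > 0 \<Longrightarrow> \<exists>\<^sub>F n in sequentially. ball x r \<inter> frontier (E n) \<noteq> {}"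
  shows "\<exists>y z. ball y \<delta> \<subseteq> L \<and> norm (x - y) = \<delta> \<and> ball z \<delta> \<subseteq> - L \<and> norm (x - z) = \<delta>"
proof -
  have "\<exists>n p y z. n \<ge> k \<and> dist x p < 1 / (real k + 1) \<and> ball y \<delta> \<subseteq> E n \<and> norm (p - y) = \<delta>
      \<and> ball z \<delta> \<subseteq> - E n \<and> norm (p - z) = \<delta>" for k
  proof -
    have "\<exists>\<^sub>F n in sequentially. ball x (1 / (real k + 1)) \<inter> frontier (E n) \<noteq> {}"
      by (rule fr) simp
    then obtain n p where "n \<ge> k" "dist x p < 1 / (real k + 1)" "p \<in> frontier (E n)"
      unfolding frequently_sequentially by fastforce
    then show ?thesis using bc[of n] unfolding ball_condition_def by blast
  qed
  then obtain N p y z where N: "\<And>k. N k \<ge> k" and p: "\<And>k. dist x (p k) < 1 / (real k + 1)"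
    and y: "\<And>k. ball (y k) \<delta> \<subseteq> E (N k)" "\<And>k. norm (p k - y k) = \<delta>"
    and z: "\<And>k. ball (z k) \<delta> \<subseteq> - E (N k)" "\<And>k. norm (p k - z k) = \<delta>"
    by metis
  have plim: "p \<longlonglongrightarrow> x"
  proof (rule metric_tendsto_imp_tendsto)
    show "(\<lambda>k. 1 / (real k + 1)) \<longlonglongrightarrow> 0"
      using LIMSEQ_inverse_real_of_nat by (simp add: inverse_eq_divide add.commute)
    show "\<forall>\<^sub>F k in sequentially. dist (p k) x \<le> dist (1 / (real k + 1)) 0"
      using p by (auto simp: dist_commute intro!: always_eventually less_imp_le)
  qed
  have "dist x (y k) \<le> 1 + \<delta>" "dist x (z k) \<le> 1 + \<delta>" for k
  proof -
    have "1 / (real k + 1) \<le> 1" by simp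
    with p[of k] have "dist x (p k) \<le> 1" by linarith
    then show "dist x (y k) \<le> 1 + \<delta>" "dist x (z k) \<le> 1 + \<delta>"
      using dist_triangle[of x "y k" "p k"] dist_triangle[of x "z k" "p k"] y(2)[of k] z(2)[of k]
      by (simp_all add: dist_norm)
  qed
  then have "\<forall>k. (y k, z k) \<in> cball x (1 + \<delta>) \<times> cball x (1 + \<delta>)" by simp
  then obtain l r where r: "strict_mono (r :: nat \<Rightarrow> nat)" and l: "((\<lambda>k. (y k, z k)) \<circ> r) \<longlonglongrightarrow> l"
    by (rule seq_compactE[OF compact_imp_seq_compact[OF compact_Times[OF compact_cball compact_cball]]])
  have ylim: "(\<lambda>k. y (r k)) \<longlonglongrightarrow> fst l" and zlim: "(\<lambda>k. z (r k)) \<longlonglongrightarrow> snd l"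
    using tendsto_fst[OF l] tendsto_snd[OF l] by (simp_all add: o_def)
  have plim': "(\<lambda>k. p (r k)) \<longlonglongrightarrow> x"
    using LIMSEQ_subseq_LIMSEQ[OF plim r] by (simp add: o_def)
  \<comment> \<open>The chosen indices \<open>N k\<close> need not be monotone, but
    \<open>N k \<ge> k\<close> suffices to turn a property of almost all \<open>N (r k)\<close> into
    one of infinitely many \<open>n\<close>.\<close>
  have freq: "\<exists>\<^sub>F n in sequentially. P n" if ev: "\<forall>\<^sub>F k in sequentially. P (N (r k))" for P
    unfolding frequently_sequentially
  proof
    fix m
    obtain K where "\<forall>k\<ge>K. P (N (r k))" using ev unfolding eventually_sequentially by blast
    then have "P (N (r (max K m)))" by simp
    moreover have "m \<le> N (r (max K m))"
      using N[of "r (max K m)"] seq_suble[OF r, of "max K m"] by linarith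
    ultimately show "\<exists>n\<ge>m. P n" by blast
  qed
  have "norm (x - fst l) = \<delta>"
    using tendsto_norm[OF tendsto_diff[OF plim' ylim]] by (simp add: y(2) LIMSEQ_const_iff)
  moreover have "norm (x - snd l) = \<delta>"
    using tendsto_norm[OF tendsto_diff[OF plim' zlim]] by (simp add: z(2) LIMSEQ_const_iff)
  moreover have "ball (fst l) \<delta> \<subseteq> L"
  proof
    fix w assume "w \<in> ball (fst l) \<delta>"
    then have "\<forall>\<^sub>F k in sequentially. dist (y (r k)) w < \<delta>"
      using tendsto_dist[OF ylim tendsto_const[of w]] by (auto intro: order_tendstoD)
    then have "\<forall>\<^sub>F k in sequentially. w \<in> E (N (r k))"
      by eventually_elim (use y(1) in \<open>auto simp: subset_eq\<close>)
    then show "w \<in> L" by (intro hausdorff_limit_memI freq)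
  qed
  moreover have "ball (snd l) \<delta> \<subseteq> - L"
  proof
    fix w assume w: "w \<in> ball (snd l) \<delta>"
    \<comment> \<open>Half of the slack is reserved for the motion of the centres; the other half
      leaves a ball of fixed radius around \<open>w\<close>, as
      \<open>hausdorff_limit_notmemI\<close> demands.\<close>
    define s where "s = (\<delta> - dist (snd l) w) / 2"
    have s: "s > 0" "dist (snd l) w < \<delta> - s" using w by (auto simp: s_def field_simps)
    have "\<forall>\<^sub>F k in sequentially. dist (z (r k)) w < \<delta> - s"
      using tendsto_dist[OF zlim tendsto_const[of w]] s(2) by (auto intro: order_tendstoD)
    then have "\<forall>\<^sub>F k in sequentially. ball w s \<subseteq> - E (N (r k))"
    proof eventually_elim
      case (elim k)
      have "ball w s \<subseteq> ball (z (r k)) \<delta>"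
      proof
        fix v assume "v \<in> ball w s"
        then show "v \<in> ball (z (r k)) \<delta>"
          using elim dist_triangle[of "z (r k)" v w] by simp
      qed
      then show ?case using z(1) by blast
    qed
    from hausdorff_limit_notmemI[OF freq[OF this] s(1)] show "w \<in> - L" by simp
  qed
  ultimately show ?thesis by blast
qed

text \<open>A ball is connected, so one that misses the frontier of \<open>E n\<close> and contains
  a point of \<open>E n\<close> lies in \<open>E n\<close>. Such a point exists eventually because
  \<open>x\<close> is in the limit.\<close>

lemma hausdorff_limit_interior:
  assumes "r > 0" "\<forall>\<^sub>F n in sequentially. ball x r \<inter> frontier (E n) = {}" "x \<in> L"
  shows "\<forall>\<^sub>F n in sequentially. ball x r \<subseteq> E n" "x \<in> interior L"
proof -
  have "\<forall>\<^sub>F n in sequentially. \<forall>x\<in>L. infdist x (E n) \<le> r / 2"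
    using \<open>r > 0\<close> by (intro hausdorff_converges_eventually) simp
  with assms(2) show ev: "\<forall>\<^sub>F n in sequentially. ball x r \<subseteq> E n"
  proof eventually_elim
    case (elim n)
    then have "infdist x (E n) < r" using assms by auto
    then obtain e where "e \<in> E n" "dist x e < r"
      using infdist_less_imp_ex E by blast
    then show ?case
      using connected_Int_frontier[of "ball x r" "E n"] elim(1) by fastforce
  qed
  have "ball x r \<subseteq> L"
  proof
    fix w assume "w \<in> ball x r"
    with ev have "\<forall>\<^sub>F n in sequentially. w \<in> E n" by (auto elim!: eventually_mono simp del: mem_ball)
    then show "w \<in> L" by (intro hausdorff_limit_memI eventually_frequently) auto
  qed
  then show "x \<in> interior L"
    using assms(1) by (meson centre_in_ball interior_maximal open_ball subsetD)
qed

text \<open>By \<open>hausdorff_limit_interior\<close> a point of \<open>L\<close> not approached by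
  frontiers is interior, so every frontier point of \<open>L\<close> is a limit of frontier points
  along infinitely many \<open>n\<close>.\<close>

lemma hausdorff_limit_ball_condition:
  assumes bc: "\<And>n. ball_condition \<delta> (E n)" and "\<delta> > 0"
  shows "ball_condition \<delta> L"
  unfolding ball_condition_def
proof
  fix x assume x: "x \<in> frontier L"
  then have "x \<in> L" "x \<notin> interior L" using L(1) frontier_subset_closed by (auto simp: frontier_def)
  then have "\<exists>\<^sub>F n in sequentially. ball x r \<inter> frontier (E n) \<noteq> {}" if "r > 0" for r
    using hausdorff_limit_interior(2)[OF that] by (auto simp: frequently_def)
  from hausdorff_limit_balls[OF assms this]
  show "(\<exists>y. ball y \<delta> \<subseteq> L \<and> norm (x - y) = \<delta>) \<and> (\<exists>z. ball z \<delta> \<subseteq> - L \<and> norm (x - z) = \<delta>)" by blast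
qed

text \<open>An interior point of \<open>L\<close> cannot be approached by frontiers: the limiting
  exterior ball would avoid \<open>L\<close> and have the point in its closure.\<close>

lemma hausdorff_limit_eventually_mem_iff:
  assumes bc: "\<And>n. ball_condition \<delta> (E n)" and "\<delta> > 0" and x: "x \<notin> frontier L"
  shows "\<forall>\<^sub>F n in sequentially. x \<in> E n \<longleftrightarrow> x \<in> L"
proof (cases "x \<in> L")
  case False
  then show ?thesis
    using hausdorff_limit_memI[of x] by (auto simp: frequently_def)
next
  case True
  with x have int: "x \<in> interior L" by (metis DiffI closure_subset frontier_def subsetD)
  have "\<exists>r>0. \<forall>\<^sub>F n in sequentially. ball x r \<inter> frontier (E n) = {}"
  proof (rule ccontr)
    assume "\<not> ?thesis"
    then have "\<exists>\<^sub>F n in sequentially. ball x r \<inter> frontier (E n) \<noteq> {}" if "r > 0" for r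
      using that by (auto simp: frequently_def)
    from hausdorff_limit_balls[OF assms(1,2) this]
    obtain z where z: "ball z \<delta> \<subseteq> - L" "norm (x - z) = \<delta>" by blast
    have "x \<in> closure (ball z \<delta>)" using z(2) \<open>\<delta> > 0\<close> by (simp add: dist_norm norm_minus_commute)
    then have "x \<in> closure (- L)" using closure_mono[OF z(1)] by blast
    then show False using int by (simp add: closure_complement)
  qed
  then obtain r where r: "r > 0" "\<forall>\<^sub>F n in sequentially. ball x r \<inter> frontier (E n) = {}" by blast
  from hausdorff_limit_interior(1)[OF r True] show ?thesis
    by eventually_elim (use True r(1) in auto)
qed

text \<open>A splitting of the compact limit has a positive gap \<open>d\<close>. The
  \<open>d / 3\<close>-neighbourhoods of the two pieces are disjoint and would split
  \<open>E n\<close> for large \<open>n\<close>.\<close>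

lemma hausdorff_limit_connected:
  assumes con: "\<And>n. connected (E n)" and "compact L"
  shows "connected L"
proof (rule ccontr)
  assume "\<not> connected L"
  then obtain A B where AB: "closed A" "closed B" "A \<noteq> {}" "B \<noteq> {}" "A \<union> B = L" "A \<inter> B = {}"
    using L(1) connected_closed_set by blast
  have "compact A" using AB \<open>compact L\<close> by (metis compact_Int_closed inf_sup_absorb inf_commute)
  then obtain d where d: "d > 0" "\<And>x y. x \<in> A \<Longrightarrow> y \<in> B \<Longrightarrow> d \<le> dist x y"
    using separate_compact_closed[of A B] AB by blast
  let ?U = "\<lambda>A. {x. infdist x A < d / 3}"
  have op: "open (?U S)" for S :: "'a set"
    by (intro open_Collect_less continuous_intros)
  have near: "\<exists>l\<in>S. dist x l < d / 3" if "infdist x S < d / 3" "S \<noteq> {}" for x and S :: "'a set"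
    using infdist_less_imp_ex that by blast
  \<comment> \<open>The bound \<open>d / 4\<close> provides the strict inequalities with
    \<open>d / 3\<close> below.\<close>
  have "\<forall>\<^sub>F n in sequentially. (\<forall>x\<in>E n. infdist x L \<le> d / 4) \<and> (\<forall>x\<in>L. infdist x (E n) \<le> d / 4)"
    using d(1) by (intro eventually_conj hausdorff_converges_eventually) auto
  from eventually_happens'[OF sequentially_bot this]
  obtain n where n: "\<And>x. x \<in> E n \<Longrightarrow> infdist x L \<le> d / 4" "\<And>x. x \<in> L \<Longrightarrow> infdist x (E n) \<le> d / 4"
    by blast
  have "?U A \<inter> ?U B \<inter> E n = {}"
  proof -
    have False if x: "x \<in> ?U A" "x \<in> ?U B" for x
    proof -
      obtain a b where "a \<in> A" "dist x a < d / 3" "b \<in> B" "dist x b < d / 3"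
        using near[of x A] near[of x B] x AB(3,4) by blast
      then show False using d(1) d(2)[of a b] dist_triangle3[of a b x] by auto
    qed
    then show ?thesis by blast
  qed
  moreover have "E n \<subseteq> ?U A \<union> ?U B"
  proof
    fix x assume "x \<in> E n"
    then have "infdist x L < d / 3" using n(1) d(1) by fastforce
    then obtain l where "l \<in> L" "dist x l < d / 3" using near L(2) by blast
    then show "x \<in> ?U A \<union> ?U B"
      using AB(5) infdist_le[of l A x] infdist_le[of l B x] by fastforce
  qed
  moreover have "?U S \<inter> E n \<noteq> {}" if S: "S \<noteq> {}" "S \<subseteq> L" for S
  proof -
    obtain a where a: "a \<in> S" using S by blast
    then have "infdist a (E n) < d / 3" using n(2)[of a] d(1) S by fastforce
    then obtain e where "e \<in> E n" "dist a e < d / 3" using near E by blast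
    then have "e \<in> ?U S" using infdist_le[OF a, of e] by (simp add: dist_commute)
    then show ?thesis using \<open>e \<in> E n\<close> by blast
  qed
  ultimately show False
    using connectedD[OF con[of n] op[of A] op[of B]] AB by blast
qed

end

subsection \<open>Existence of minimizers\<close>

text \<open>Either the \<open>\<delta>\<close>-ball about \<open>x\<close> already lies in
  \<open>E\<close>, or a boundary point is closer than \<open>\<delta>\<close>, and its interior
  tangent ball serves.\<close>

lemma ball_condition_inner_ball:
  fixes E :: "'a::euclidean_space set"
  assumes "ball_condition \<delta> E" "x \<in> E" "\<delta> > 0"
  obtains y where "ball y \<delta> \<subseteq> E" "dist x y \<le> 2 * \<delta>"
proof (cases "ball x \<delta> \<subseteq> E")
  case True
  then show ?thesis using that[of x] assms(3) by simp
next
  case False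
  then obtain w where w: "w \<notin> E" "dist x w < \<delta>" by (auto simp: subset_eq)
  obtain p where p: "p \<in> closed_segment x w" "p \<in> frontier E"
    using segment_crosses_frontier[OF assms(2) w(1)] .
  then obtain y where y: "ball y \<delta> \<subseteq> E" "norm (p - y) = \<delta>"
    using assms(1) unfolding ball_condition_def by blast
  have "dist x p \<le> dist x w"
    using segment_bound(1)[OF p(1)] by (simp add: dist_norm norm_minus_commute)
  then have "dist x y \<le> 2 * \<delta>"
    using dist_triangle[of x y p] y(2) w(2) by (simp add: dist_norm)
  with y(1) that show ?thesis by blast
qed

text \<open>By connectedness the distance from \<open>x0\<close> takes every value up to
  \<open>D\<close> on \<open>E\<close>. Sampling these values yields disjoint interior balls in a
  number proportional to \<open>D\<close>, which the volume of \<open>E\<close> limits.\<close>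

lemma connected_ball_condition_bounded:
  fixes E :: "'a::euclidean_space set"
  assumes E: "connected E" "ball_condition \<delta> E" "\<delta> > 0" "E \<in> lmeasurable" and x0: "x0 \<in> E"
  shows "E \<subseteq> cball x0 (6 * \<delta> * (measure lebesgue E / measure lebesgue (ball (0::'a) \<delta>) + 1))"
proof
  fix x1 assume x1: "x1 \<in> E"
  define D where "D = dist x0 x1"
  define b where "b = measure lebesgue (ball (0::'a) \<delta>)"
  have b: "b > 0" using E(3) by (simp add: b_def measure_completion)
  have "\<exists>y. ball y \<delta> \<subseteq> E \<and> \<bar>dist x0 y - s\<bar> \<le> 2 * \<delta>" if s: "0 \<le> s" "s \<le> D" for s
  proof -
    have "is_interval (dist x0 ` E)"
      unfolding is_interval_connected_1
      by (rule connected_continuous_image[OF _ E(1)]) (intro continuous_intros)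
    from mem_is_interval_1_I[OF this, of "dist x0 x0" "dist x0 x1" s] x0 x1 s
    obtain x where x: "x \<in> E" "dist x0 x = s" by (auto simp: D_def)
    obtain y where "ball y \<delta> \<subseteq> E" "dist x y \<le> 2 * \<delta>"
      using ball_condition_inner_ball[OF E(2) x(1) E(3)] .
    then show ?thesis
      using x(2) dist_triangle[of x0 y x] dist_triangle[of x0 x y]
      by (intro exI[of _ y]) (auto simp: dist_commute)
  qed
  then obtain y where y: "\<And>s. 0 \<le> s \<Longrightarrow> s \<le> D \<Longrightarrow> ball (y s) \<delta> \<subseteq> E"
    "\<And>s. 0 \<le> s \<Longrightarrow> s \<le> D \<Longrightarrow> \<bar>dist x0 (y s) - s\<bar> \<le> 2 * \<delta>" by metis
  \<comment> \<open>Centres deviate by at most \<open>2 * \<delta>\<close> from the sampled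
    distances, so spacing \<open>6 * \<delta>\<close> leaves them at least
    \<open>2 * \<delta>\<close> apart. Rounding down to \<open>N\<close> causes the
    \<open>+ 1\<close> in the bound.\<close>
  define N where "N = nat \<lfloor>D / (6 * \<delta>)\<rfloor>"
  have "D / (6 * \<delta>) \<ge> 0" using E(3) by (simp add: D_def)
  then have N: "real N \<le> D / (6 * \<delta>)" "D / (6 * \<delta>) \<le> real N + 1"
    unfolding N_def by linarith+
  have ND: "6 * \<delta> * real i \<le> D" "0 \<le> 6 * \<delta> * real i" if "i < N" for i
  proof -
    have "6 * \<delta> * real i \<le> 6 * \<delta> * real N" using that E(3) by simp
    also have "\<dots> \<le> D" using N(1) E(3) by (simp add: field_simps)
    finally show "6 * \<delta> * real i \<le> D" .
  qed (use E(3) in simp)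
  have sep: "disjnt (ball (y (6 * \<delta> * real i)) \<delta>) (ball (y (6 * \<delta> * real j)) \<delta>)"
    if "i < j" "j < N" for i j
  proof -
    have "6 * \<delta> * (real i + 1) \<le> 6 * \<delta> * real j"
      using that E(3) by (intro mult_left_mono) auto
    then have "2 * \<delta> \<le> dist x0 (y (6 * \<delta> * real j)) - dist x0 (y (6 * \<delta> * real i))"
      using y(2)[OF ND(2,1), of i] y(2)[OF ND(2,1), of j] that by (auto simp: algebra_simps)
    also have "\<dots> \<le> dist (y (6 * \<delta> * real i)) (y (6 * \<delta> * real j))"
      using dist_triangle[of x0 "y (6 * \<delta> * real j)" "y (6 * \<delta> * real i)"] by simp
    finally have far: "2 * \<delta> \<le> dist (y (6 * \<delta> * real i)) (y (6 * \<delta> * real j))" .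
    show ?thesis
    proof -
      have False if "z \<in> ball (y (6 * \<delta> * real i)) \<delta>" "z \<in> ball (y (6 * \<delta> * real j)) \<delta>" for z
        using that far dist_triangle2[of "y (6 * \<delta> * real i)" "y (6 * \<delta> * real j)" z] by auto
      then show ?thesis unfolding disjnt_def by blast
    qed
  qed
  have "real (card {..<N}) * b \<le> measure lebesgue E"
  proof (rule card_times_measure_le[where F = "\<lambda>i. ball (y (6 * \<delta> * real i)) \<delta>"])
    show "pairwise (\<lambda>i j. disjnt (ball (y (6 * \<delta> * real i)) \<delta>) (ball (y (6 * \<delta> * real j)) \<delta>)) {..<N}"
    proof (rule pairwiseI)
      fix i j assume "i \<in> {..<N}" "j \<in> {..<N}" "i \<noteq> j"
      then show "disjnt (ball (y (6 * \<delta> * real i)) \<delta>) (ball (y (6 * \<delta> * real j)) \<delta>)"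
        using sep[of i j] sep[of j i] by (cases i j rule: linorder_cases) (auto simp: disjnt_sym)
    qed
    show "b \<le> measure lebesgue (ball (y (6 * \<delta> * real i)) \<delta>)" for i
      using E(3) by (simp add: b_def content_ball)
  qed (use y(1) ND E(4) in auto)
  then have "real N \<le> measure lebesgue E / b" using b by (simp add: field_simps)
  with N(2) have "D / (6 * \<delta>) \<le> measure lebesgue E / b + 1" by linarith
  then have "D \<le> 6 * \<delta> * (measure lebesgue E / b + 1)"
    using E(3) by (simp add: field_simps)
  then show "x1 \<in> cball x0 (6 * \<delta> * (measure lebesgue E / measure lebesgue (ball (0::'a) \<delta>) + 1))"
    by (simp add: D_def b_def)
qed

lemma cball_in_K_class_co:
  fixes r \<delta> :: real
  assumes "0 < \<delta>" "\<delta> \<le> r"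
  shows "cball (0::'a::euclidean_space) r \<in> K_class_co \<delta>"
proof -
  have "ball_condition \<delta> (cball (0::'a) r)"
    unfolding ball_condition_def
  proof (intro ballI conjI)
    fix x :: 'a assume "x \<in> frontier (cball 0 r)"
    then have x: "norm x = r" using assms by simp
    \<comment> \<open>Centres on the ray through \<open>x\<close>, at distance
      \<open>\<delta>\<close> inside and outside the sphere; \<open>\<delta> \<le> r\<close> gives
      \<open>norm ?y = r - \<delta>\<close>.\<close>
    let ?y = "(1 - \<delta> / r) *\<^sub>R x" and ?z = "(1 + \<delta> / r) *\<^sub>R x"
    have "norm ?y = r - \<delta>" "norm ?z = r + \<delta>"
      using x assms by (auto simp: field_simps)
    moreover have "norm (x - ?y) = \<delta>" "norm (x - ?z) = \<delta>"
      using x assms by (auto simp: algebra_simps)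
    moreover have "ball ?y \<delta> \<subseteq> cball 0 r"
    proof
      fix w assume "w \<in> ball ?y \<delta>"
      then show "w \<in> cball 0 r"
        using norm_triangle_sub[of w ?y] \<open>norm ?y = r - \<delta>\<close> by (auto simp: dist_norm norm_minus_commute)
    qed
    moreover have "ball ?z \<delta> \<subseteq> - cball 0 r"
    proof
      fix w assume "w \<in> ball ?z \<delta>"
      then show "w \<in> - cball 0 r"
        using norm_triangle_sub[of ?z w] \<open>norm ?z = r + \<delta>\<close> by (auto simp: dist_norm)
    qed
    ultimately show "\<exists>y. ball y \<delta> \<subseteq> cball 0 r \<and> norm (x - y) = \<delta>"
      "\<exists>z. ball z \<delta> \<subseteq> - cball 0 r \<and> norm (x - z) = \<delta>" by blast+
  qed
  then show ?thesis unfolding K_class_co_def K_class_def by (simp add: convex_connected)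
qed

text \<open>Volume is the integral of the indicator of the common set \<open>B\<close>, whose finite
  measure prevents mass from escaping.\<close>

lemma measure_tendsto_of_eventually_mem_iff:
  fixes E :: "nat \<Rightarrow> 'a::euclidean_space set"
  assumes E: "\<And>n. E n \<in> sets lebesgue" "L \<in> sets lebesgue"
    and lim: "AE x in lebesgue. \<forall>\<^sub>F n in sequentially. x \<in> E n \<longleftrightarrow> x \<in> L"
    and sub: "\<And>n. E n \<subseteq> B" "L \<subseteq> B" "B \<in> lmeasurable"
  shows "(\<lambda>n. measure lebesgue (E n)) \<longlonglongrightarrow> measure lebesgue L"
proof -
  have eq: "set_lebesgue_integral lebesgue S (indicat_real B) = measure lebesgue S"
    if "S \<subseteq> B" "S \<in> sets lebesgue" for S
  proof -
    have "S \<in> lmeasurable" using that sub(3) fmeasurableI2 by blast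
    moreover have "(\<lambda>x. indicat_real S x *\<^sub>R indicat_real B x) = indicat_real S"
      using that(1) by (auto simp: fun_eq_iff indicator_def)
    ultimately show ?thesis unfolding set_lebesgue_integral_def by simp
  qed
  have "integrable lebesgue (indicat_real B)"
    using sub(3) by (intro integrable_real_indicator) (auto simp: fmeasurable_def)
  from set_lebesgue_integral_tendsto[OF this E lim] show ?thesis
    using eq[OF sub(1) E(1)] eq[OF sub(2) E(2)] by simp
qed

text \<open>For a fixed test field and a fixed \<open>a < 1\<close> the divergence integral
  converges and the Riesz term is bounded below for large \<open>n\<close>. Then comes the supremum
  over fields, and finally \<open>a\<close> tends to 1.\<close>

lemma charged_energy_lower_semicontinuous:
  fixes E :: "nat \<Rightarrow> 'a::euclidean_space set"
  assumes H: "hausdorff_converges E L" and L: "compact L" "L \<noteq> {}" "ball_condition \<delta> L" "\<delta> > 0"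
    and E: "\<And>n. closed (E n)" "\<And>n. E n \<noteq> {}" and \<alpha>: "0 < \<alpha>"
    and lim: "AE x in lebesgue. \<forall>\<^sub>F n in sequentially. x \<in> E n \<longleftrightarrow> x \<in> L"
    and c: "(\<lambda>n. charged_energy \<alpha> Q (E n)) \<longlonglongrightarrow> c"
  shows "charged_energy \<alpha> Q L \<le> c"
proof -
  let ?T = "{T \<in> C1_compact_support. \<forall>x. norm (T x :: 'a) \<le> 1}"
  let ?R = "ennreal (Q\<^sup>2) * riesz_energy \<alpha> L"
  have step: "ennreal (set_lebesgue_integral lebesgue L (divergence T)) + ennreal a * ?R \<le> c"
    if T: "T \<in> ?T" and a: "0 < a" "a < 1" for T a
  proof (rule LIMSEQ_le)
    show "(\<lambda>n. charged_energy \<alpha> Q (E n)) \<longlonglongrightarrow> c" by (rule c)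
    have "E n \<in> sets lebesgue" "L \<in> sets lebesgue" for n
      using E(1) compact_imp_closed[OF L(1)] by auto
    then show "(\<lambda>n. ennreal (set_lebesgue_integral lebesgue (E n) (divergence T)) + ennreal a * ?R)
        \<longlonglongrightarrow> ennreal (set_lebesgue_integral lebesgue L (divergence T)) + ennreal a * ?R"
      using T by (intro tendsto_add tendsto_const tendsto_ennrealI set_lebesgue_integral_tendsto lim)
        (auto intro: C1_compact_support_divergence)
    obtain \<epsilon> where \<epsilon>: "\<epsilon> > 0" "\<And>F. F \<in> sets borel \<Longrightarrow> (\<forall>y\<in>F. infdist y L \<le> \<epsilon>) \<Longrightarrow>
      ennreal a * riesz_energy \<alpha> L \<le> riesz_energy \<alpha> F"
      using riesz_energy_neighbourhood[OF L \<alpha> a] by blast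
    have "\<forall>\<^sub>F n in sequentially. \<forall>x\<in>E n. infdist x L \<le> \<epsilon>"
      using hausdorff_converges_eventually(1)[OF H _ L(2) E(2) \<epsilon>(1)] L(1) compact_imp_closed by blast
    then have "\<forall>\<^sub>F n in sequentially. ennreal (set_lebesgue_integral lebesgue (E n) (divergence T)) + ennreal a * ?R
        \<le> charged_energy \<alpha> Q (E n)"
    proof eventually_elim
      case (elim n)
      have "ennreal (Q\<^sup>2) * (ennreal a * riesz_energy \<alpha> L) \<le> ennreal (Q\<^sup>2) * riesz_energy \<alpha> (E n)"
        using \<epsilon>(2)[OF borel_closed[OF E(1)] elim] by (intro mult_left_mono) auto
      moreover have "ennreal (set_lebesgue_integral lebesgue (E n) (divergence T)) \<le> perimeter (E n)"
        unfolding perimeter_def using T by (intro SUP_upper)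
      ultimately show ?case
        unfolding charged_energy_def by (intro add_mono) (simp_all add: mult.left_commute)
    qed
    then show "\<exists>N. \<forall>n\<ge>N. ennreal (set_lebesgue_integral lebesgue (E n) (divergence T)) + ennreal a * ?R
        \<le> charged_energy \<alpha> Q (E n)"
      by (simp add: eventually_sequentially)
  qed
  \<comment> \<open>The constant Riesz term can be moved inside the supremum over fields only if
    some field is admissible.\<close>
  have "(\<lambda>_. 0) \<in> ?T" by (simp add: C1_compact_support_def)
  then have ne: "?T \<noteq> {}" by blast
  have per: "perimeter L + ennreal a * ?R \<le> c" if "0 < a" "a < 1" for a
    unfolding perimeter_def ennreal_SUP_add_left[OF ne, symmetric]
    using step[OF _ that] by (intro SUP_least)
  have "perimeter L + ?R \<le> c"
  proof (rule LIMSEQ_le_const2)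
    \<comment> \<open>The double \<open>Suc\<close> starts the sequence at \<open>1 / 2\<close>,
      since \<open>per\<close> excludes 0. The term \<open>?R\<close> may be infinite;
      multiplication is still continuous because the factors tend to 1.\<close>
    have "(\<lambda>n. 1 - inverse (real (Suc (Suc n)))) \<longlonglongrightarrow> 1 - 0"
      by (intro tendsto_intros LIMSEQ_Suc[OF LIMSEQ_inverse_real_of_nat])
    then have "(\<lambda>n. ennreal (1 - inverse (real (Suc (Suc n)))) * ?R) \<longlonglongrightarrow> ennreal 1 * ?R"
      by (intro tendsto_mult_ennreal tendsto_ennrealI tendsto_const) auto
    then show "(\<lambda>n. perimeter L + ennreal (1 - inverse (real (Suc (Suc n)))) * ?R) \<longlonglongrightarrow> perimeter L + ?R"
      by (intro tendsto_add tendsto_const) simp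
    show "\<exists>N. \<forall>n\<ge>N. perimeter L + ennreal (1 - inverse (real (Suc (Suc n)))) * ?R \<le> c"
      by (intro exI[of _ 0] allI impI per) (auto simp: field_simps)
  qed
  then show ?thesis unfolding charged_energy_def .
qed

theorem theorem1p5:
  fixes \<alpha> \<delta> m Q :: real
  assumes "DIM('a::euclidean_space) \<ge> 2"
    and "0 < \<alpha>" and "\<alpha> < real DIM('a)"
    and "\<delta> > 0"
    and "m \<ge> unit_ball_vol (real DIM('a)) * \<delta> ^ DIM('a)"
    and "Q \<ge> 0"
  shows "\<exists>E :: 'a set. E \<in> K_class_co \<delta> \<and> emeasure lebesgue E = ennreal m \<and>
           (\<forall>F :: 'a set. F \<in> K_class_co \<delta> \<and> emeasure lebesgue F = ennreal m \<longrightarrow>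
              charged_energy \<alpha> Q E \<le> charged_energy \<alpha> Q F)"
proof -
  define \<omega> where "\<omega> = unit_ball_vol (real DIM('a))"
  have \<omega>: "\<omega> > 0" by (simp add: \<omega>_def)
  have "\<omega> * \<delta> ^ DIM('a) > 0" using \<omega> assms(4) by simp
  then have m: "m > 0" using assms(5) by (simp add: \<omega>_def)
  define C where "C = {F :: 'a set. F \<in> K_class_co \<delta> \<and> emeasure lebesgue F = ennreal m}"
  have "C \<noteq> {}"
  proof -
    \<comment> \<open>The radius of the ball of volume \<open>m\<close>; the lower bound on
      \<open>m\<close> says exactly that \<open>\<delta> \<le> r\<close>, so this ball is
      admissible.\<close>
    define r where "r = root DIM('a) (m / \<omega>)"
    have r: "r ^ DIM('a) = m / \<omega>"
      using m \<omega> by (simp add: r_def)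
    have "\<delta> ^ DIM('a) \<le> m / \<omega>"
      using assms(5) \<omega> by (simp add: \<omega>_def[symmetric] field_simps)
    then have "root DIM('a) (\<delta> ^ DIM('a)) \<le> r"
      unfolding r_def by (intro real_root_le_mono) auto
    then have "\<delta> \<le> r" using assms(4) by (simp add: real_root_power_cancel)
    moreover have "emeasure lebesgue (cball (0::'a) r) = ennreal m"
      using r \<omega> \<open>\<delta> \<le> r\<close> assms(4) emeasure_cball[of r "0::'a"] by (auto simp: \<omega>_def)
    ultimately have "cball 0 r \<in> C"
      using cball_in_K_class_co[OF assms(4)] by (simp add: C_def)
    then show ?thesis by blast
  qed
  \<comment> \<open>The infimum is taken in \<open>ennreal\<close> and may be infinite; the argument
    covers that case as well.\<close>
  let ?c = "Inf (charged_energy \<alpha> Q ` C)"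
  have "\<exists>u. (\<forall>n. u n \<in> charged_energy \<alpha> Q ` C) \<and> u \<longlonglongrightarrow> ?c"
    using \<open>C \<noteq> {}\<close> by (intro Inf_as_limit) simp
  then obtain u where "\<forall>n. u n \<in> charged_energy \<alpha> Q ` C" and u: "u \<longlonglongrightarrow> ?c" by blast
  then have "\<forall>n. \<exists>F. F \<in> C \<and> u n = charged_energy \<alpha> Q F" by blast
  then obtain F where F: "\<And>n. F n \<in> C" "\<And>n. u n = charged_energy \<alpha> Q (F n)" by metis
  have C_meas: "S \<in> lmeasurable" "measure lebesgue S = m" "S \<noteq> {}" if "S \<in> C" for S
  proof -
    have e: "emeasure lebesgue S = ennreal m" "closed S"
      using that by (auto simp: C_def K_class_co_def K_class_def)
    then show "S \<in> lmeasurable" "measure lebesgue S = m"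
      using m by (auto simp: fmeasurable_def measure_def)
    show "S \<noteq> {}" using e m by auto
  qed
  have "\<forall>n. \<exists>a. a \<in> F n" using C_meas(3)[OF F(1)] by blast
  then obtain a where a: "\<And>n. a n \<in> F n" by metis
  \<comment> \<open>After translation all sets contain the origin and have volume \<open>m\<close>,
    so the diameter bound places them in one ball \<open>cball 0 R\<close>.\<close>
  define G where "G n = (+) (- a n) ` F n" for n
  have GC: "G n \<in> C" for n
  proof -
    have "G n \<in> lmeasurable" "measure lebesgue (G n) = m"
      using C_meas[OF F(1)] unfolding G_def by (simp_all only: measurable_translation measure_translation)
    then have "emeasure lebesgue (G n) = ennreal m" by (simp add: emeasure_eq_measure2)
    moreover have "G n \<in> K_class_co \<delta>"
      unfolding G_def using F(1)[of n] by (intro K_class_co_translate) (simp add: C_def)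
    ultimately show ?thesis by (simp add: C_def)
  qed
  have G: "closed (G n)" "ball_condition \<delta> (G n)" "connected (G n)" "G n \<noteq> {}" for n
    using GC[of n] C_meas(3) by (auto simp: C_def K_class_co_def K_class_def)
  have G0: "0 \<in> G n" for n
    using a by (auto simp: G_def intro!: image_eqI[of _ _ "a n"])
  have Glim: "(\<lambda>n. charged_energy \<alpha> Q (G n)) \<longlonglongrightarrow> ?c"
  proof (rule tendsto_sandwich)
    show "\<forall>\<^sub>F n in sequentially. ?c \<le> charged_energy \<alpha> Q (G n)"
      using GC by (auto intro!: always_eventually INF_lower)
    show "\<forall>\<^sub>F n in sequentially. charged_energy \<alpha> Q (G n) \<le> u n"
    proof (intro always_eventually allI)
      fix n
      have "closed (F n)" using F(1)[of n] by (simp add: C_def K_class_co_def K_class_def)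
      then show "charged_energy \<alpha> Q (G n) \<le> u n"
        unfolding F(2) G_def using assms(2) by (rule charged_energy_translate_le)
    qed
  qed (auto intro: u)
  define R where "R = 6 * \<delta> * (m / measure lebesgue (ball (0::'a) \<delta>) + 1)"
  have GR: "G n \<subseteq> cball 0 R" for n
    using connected_ball_condition_bounded[OF G(3,2) assms(4) C_meas(1)[OF GC] G0]
    by (simp only: R_def C_meas(2)[OF GC])
  obtain k L where k: "strict_mono (k :: nat \<Rightarrow> nat)" and L: "compact L" "L \<noteq> {}" "L \<subseteq> cball 0 R"
    and H: "hausdorff_converges (G \<circ> k) L"
    by (rule blaschke_selection[OF G(1,4) GR])
  have E: "closed ((G \<circ> k) n)" "ball_condition \<delta> ((G \<circ> k) n)" "connected ((G \<circ> k) n)" "(G \<circ> k) n \<noteq> {}" for n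
    using G by (simp_all add: o_def)
  have cl: "closed L" using L(1) by (rule compact_imp_closed)
  have bc: "ball_condition \<delta> L"
    by (rule hausdorff_limit_ball_condition[OF H cl L(2) E(4) E(2) assms(4)])
  have con: "connected L"
    by (rule hausdorff_limit_connected[OF H cl L(2) E(4) E(3) L(1)])
  have lim: "AE x in lebesgue. \<forall>\<^sub>F n in sequentially. x \<in> (G \<circ> k) n \<longleftrightarrow> x \<in> L"
  proof (rule AE_I')
    show "frontier L \<in> null_sets lebesgue"
      using negligible_frontier_ball_condition[OF bc assms(4)] by (simp add: negligible_iff_null_sets)
    show "{x \<in> space lebesgue. \<not> (\<forall>\<^sub>F n in sequentially. x \<in> (G \<circ> k) n \<longleftrightarrow> x \<in> L)} \<subseteq> frontier L"
      using hausdorff_limit_eventually_mem_iff[OF H cl L(2) E(4) E(2) assms(4)] by blast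
  qed
  have "(\<lambda>n. measure lebesgue ((G \<circ> k) n)) \<longlonglongrightarrow> measure lebesgue L"
    using E(1) cl GR L(3) by (intro measure_tendsto_of_eventually_mem_iff[OF _ _ lim, of "cball 0 R"]) auto
  then have "measure lebesgue L = m"
    using C_meas(2)[OF GC] by (simp add: o_def LIMSEQ_const_iff)
  moreover have "L \<in> lmeasurable" using L(1) by (rule lmeasurable_compact)
  ultimately have "emeasure lebesgue L = ennreal m" by (simp add: emeasure_eq_measure2)
  moreover have "L \<in> K_class_co \<delta>"
    using cl bc con by (simp add: K_class_co_def K_class_def)
  moreover have "charged_energy \<alpha> Q L \<le> ?c"
  proof (rule charged_energy_lower_semicontinuous[OF H L(1,2) bc assms(4) E(1,4) assms(2) lim])
    show "(\<lambda>n. charged_energy \<alpha> Q ((G \<circ> k) n)) \<longlonglongrightarrow> ?c"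
      using LIMSEQ_subseq_LIMSEQ[OF Glim k] by (simp add: o_def)
  qed
  ultimately show ?thesis
    by (intro exI[of _ L]) (auto simp: C_def intro: order_trans INF_lower)
qed

end
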